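(* Let $r\geq 3$, $k_{1}\geq k_{2}\geq\dots \geq k_{r} \geq t\ge 1$ and $n \geq \frac{r}{r-1}\cdot(k_{1}+t)+1$ be integers, and let $V$ be an $n$-dimensional vector space over $\mathbb{F}_q$. If $\mathcal{F}_{1} \subseteq { V \brack k_{1}}, \mathcal{F}_{2} \subseteq { V \brack k_{2}},\dots, \mathcal{F}_{r} \subseteq { V \brack k_{r}}$ are $r$-cross $t$-intersecting, then $$\prod_{i =1}^{r}|\mathcal{F}_{i}| \leq \prod_{i =1}^{r}{ n-t \brack k_{i}-t}.$$ Equality holds if and only if there is some $T \in {V \brack t}$ such that $\mathcal{F}_{i}=\{ F \in {V \brack k_{i}} : T \subseteq F\}$ for all $i=1,2,\ldots,r$.
   Context: $q$ is a prime power and $\mathbb{F}_q$ is the finite field with $q$ elements. ${V\brack k}$ denotes the set of all $k$-dimensional subspaces of $V$. For integers, ${a\brack b}=\prod_{i=0}^{b-1}\frac{q^{a-i}-1}{q^{b-i}-1}$ is the Gaussian binomial coefficient, with ${a\brack 0}=1$ and ${a\brack c}=0$ for $c<0$. Families $\mathcal{F}_{1} \subseteq { V \brack k_{1}},\ldots,\mathcal{F}_{r}\subseteq { V \brack k_{r}}$ are $r$-cross $t$-intersecting if $\dim(F_{1} \cap F_{2} \cap \cdots \cap F_{r}) \geq t$ for all $F_{i} \in \mathcal{F}_{i}$, $i=1,\ldots,r$. *)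

theory Defs
  imports Complex_Main
begin

text \<open>
  Here \<open>dim\<close> is \<open>0\<close> on infinite-dimensional spaces, so a positive dimension of the
  whole type forces the ambient space to be finite-dimensional.
\<close>

context vector_space
begin

definition grassmannian :: "nat \<Rightarrow> 'b set set" where
  "grassmannian k = {W. subspace W \<and> dim W = k}"

definition cross_intersecting :: "nat \<Rightarrow> nat \<Rightarrow> (nat \<Rightarrow> 'b set set) \<Rightarrow> bool" where
  "cross_intersecting r t \<F> \<longleftrightarrow>
     (\<forall>F. (\<forall>i\<in>{1..r}. F i \<in> \<F> i) \<longrightarrow> dim (\<Inter>i\<in>{1..r}. F i) \<ge> t)"

end

definition gauss_binomial :: "nat \<Rightarrow> int \<Rightarrow> int \<Rightarrow> real" where
  "gauss_binomial q a b =
     (if b < 0 then 0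
      else \<Prod>i\<in>{0..b - 1}. (real q powi (a - i) - 1) / (real q powi (b - i) - 1))"

end

theory Submission
  imports Defs
begin

text \<open>
  The bound is attained by the families of all spaces above a fixed \<open>t\<close>-space. The proof shows
  that families whose product is at least as large all consist of spaces above one such space.

  Fix such families, with \<open>n = dim V\<close>. Two quantities are weighed against each other. A family
  of \<open>k\<close>-spaces that are required to contain one more dimension becomes smaller by a factor of
  about \<open>q ^ (n - k)\<close> (\<open>card_above_le\<close>); a family whose members must meet a given space \<open>M\<close> in
  dimension \<open>t\<close> splits into about \<open>q ^ (t * (dim M - t))\<close> parts according to that intersection
  (\<open>card_meeting_le\<close>). The members of \<open>\<F> p\<close> have to meet every intersection \<open>M\<close> of members of
  the other families in dimension \<open>t\<close>, so the point is to have small \<open>M\<close> at hand.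

  This is what the lower bound on \<open>n\<close> is for. If all choices of members of the other families,
  one of which may be confined to a small proportion of its family, had an intersection of
  dimension \<open>n - k p - 1\<close> or more, then a choice with least intersection would confine all the
  families so much that their product could not be large (\<open>small_intersection\<close>).

  With small \<open>M\<close> available, let \<open>T\<close> be a \<open>t\<close>-space. Unless \<open>T\<close> is contained in almost all
  members of all other families, some \<open>M\<close> meets \<open>T\<close> in dimension less than \<open>t\<close>, and
  the members of \<open>\<F> p\<close> above \<open>T\<close> must contain one of few larger spaces. Iterating this
  (\<open>card_above_decay\<close>) and comparing with the least dimensions of spaces that meet almost all
  members of a family in dimension \<open>t\<close> yields one \<open>t\<close>-space that is contained in almost all
  members of all the families (\<open>common_cover\<close>). Finally a single member that does not contain
  this space would again provide small \<open>M\<close> and make all the other families too small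
  (\<open>branching_space_of_stray_member\<close>, \<open>common_subspace\<close>).
\<close>

section \<open>Gaussian binomial coefficients\<close>

text \<open>
  Natural number arguments suit the counting below. Subtraction truncates, but for \<open>a < s\<close>
  the factor with index \<open>a\<close> is \<open>0\<close>, as it should be.
\<close>

definition gauss :: "real \<Rightarrow> nat \<Rightarrow> nat \<Rightarrow> real" where
  "gauss Q a s = (\<Prod>i<s. (Q ^ (a - i) - 1) / (Q ^ (s - i) - 1))"

lemma gauss_0 [simp]: "gauss Q a 0 = 1"
  by (simp add: gauss_def)

lemma gauss_Suc:
  "gauss Q (Suc a) (Suc s) = (Q ^ Suc a - 1) / (Q ^ Suc s - 1) * gauss Q a s"
  unfolding gauss_def by (subst prod.lessThan_Suc_shift) simp

lemma gauss_eq_0: "a < s \<Longrightarrow> gauss Q a s = 0"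
  unfolding gauss_def by (rule prod_zero) (auto intro!: bexI[of _ a])

lemma gauss_binomial_eq_gauss:
  assumes "t \<le> k" "k \<le> n"
  shows "gauss_binomial q (int n - int t) (int k - int t) = gauss (real q) (n - t) (k - t)"
proof -
  define m where "m = k - t"
  have k: "k = m + t" using assms m_def by simp
  have "gauss_binomial q (int n - int t) (int k - int t)
      = (\<Prod>i\<in>{0..int m - 1}. (real q powi (int n - int t - i) - 1) / (real q powi (int m - i) - 1))"
    by (simp add: gauss_binomial_def k)
  also have "\<dots> = (\<Prod>i<m. (real q powi (int n - int t - int i) - 1) / (real q powi (int m - int i) - 1))"
    by (rule prod.reindex_bij_witness[of _ int nat]) auto
  also have "\<dots> = gauss (real q) (n - t) m"
    unfolding gauss_def
  proof (rule prod.cong[OF refl])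
    fix i assume i: "i \<in> {..<m}"
    have "int n - int t - int i = int (n - t - i)" "int m - int i = int (m - i)"
      using i assms k by auto
    then show "(real q powi (int n - int t - int i) - 1) / (real q powi (int m - int i) - 1)
       = (real q ^ (n - t - i) - 1) / (real q ^ (m - i) - 1)"
      by (simp only: power_int_of_nat)
  qed
  finally show ?thesis by (simp add: m_def)
qed

context
  fixes Q :: real
  assumes Q2: "Q \<ge> 2"
begin

lemma pow_gt_1: "0 < m \<Longrightarrow> Q ^ m > 1"
  using Q2 by (simp add: one_less_power)

lemma gauss_nonneg: "gauss Q a s \<ge> 0"
  unfolding gauss_def using Q2 by (intro prod_nonneg) (auto simp: one_le_power)

lemma gauss_pos: "s \<le> a \<Longrightarrow> gauss Q a s > 0"
  unfolding gauss_def by (intro prod_pos) (auto intro!: divide_pos_pos simp: pow_gt_1)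

text \<open>
  The coefficient \<open>gauss Q (e + s) s\<close> has order of magnitude \<open>Q ^ (e * s)\<close>. Written as a
  product of \<open>s\<close> quotients or as a product of \<open>e\<close> quotients, it costs a factor of at
  most \<open>Q\<close> per quotient to replace it by that power. Both forms are used: this one when
  \<open>s\<close> is the small parameter, the bound \<open>gauss_le_minus_power\<close> when \<open>e\<close> is.
\<close>

lemma gauss_le_power: "gauss Q (e + s) s \<le> Q ^ ((e + 1) * s)"
proof (induction s)
  case (Suc s)
  have p: "Q ^ Suc s - 1 > 0" using pow_gt_1[of "Suc s"] by simp
  have "1 \<le> Q ^ s" using Q2 by (simp add: one_le_power)
  have "Q ^ Suc (e + s) - 1 \<le> Q ^ (e + 1) * (Q ^ Suc s - 1)"
  proof -
    have "Q ^ (e + 1) * Q ^ Suc s = Q * Q ^ Suc (e + s)" by (simp add: power_add)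
    moreover have "Q * Q ^ Suc (e + s) \<ge> 2 * Q ^ Suc (e + s)" using Q2 by (intro mult_right_mono) auto
    moreover have "Q ^ (e + 1) \<le> Q ^ Suc (e + s)" using Q2 by (intro power_increasing) auto
    ultimately show ?thesis unfolding right_diff_distrib mult_1_right by linarith
  qed
  then have "(Q ^ Suc (e + s) - 1) / (Q ^ Suc s - 1) \<le> Q ^ (e + 1)"
    using p by (simp add: divide_le_eq)
  then have "gauss Q (Suc (e + s)) (Suc s) \<le> Q ^ (e + 1) * Q ^ ((e + 1) * s)"
    unfolding gauss_Suc using Suc gauss_nonneg Q2 by (intro mult_mono) auto
  then show ?case by (simp add: power_add algebra_simps)
qed simp

text \<open>
  The recursion in the upper index, which exhibits the coefficient as a product of \<open>e\<close>
  quotients.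
\<close>

lemma gauss_upper_Suc:
  "gauss Q (s + Suc e) s = (Q ^ (s + Suc e) - 1) / (Q ^ Suc e - 1) * gauss Q (s + e) s"
proof (induction s)
  case 0
  show ?case using pow_gt_1[of "Suc e"] by simp
next
  case (Suc s)
  show ?case
    unfolding add_Suc gauss_Suc Suc
    by (simp only: add_Suc_right times_divide_eq_left times_divide_eq_right
        divide_divide_eq_left mult_ac)
qed

text \<open>
  The base is \<open>Q ^ (s + 1) - 1\<close> and not \<open>Q ^ (s + 1)\<close>: in the comparison of covering numbers
  all the powers of \<open>Q\<close> may cancel, and then this \<open>- 1\<close> decides.
\<close>

lemma gauss_le_minus_power: "gauss Q (s + e) s \<le> (Q ^ (s + 1) - 1) ^ e"
proof (induction e)
  case 0
  have "gauss Q s s = 1"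
  proof (induction s)
    case (Suc s)
    then show ?case using pow_gt_1[of "Suc s"] by (simp add: gauss_Suc)
  qed simp
  then show ?case by simp
next
  case (Suc e)
  have p: "Q ^ Suc e - 1 > 0" using pow_gt_1[of "Suc e"] by simp
  have g1: "1 \<le> Q ^ s" "Q \<le> Q ^ Suc e" using Q2 power_increasing[of 1 "Suc e" Q] by (auto simp: one_le_power)
  have "Q ^ (s + Suc e) - 1 \<le> (Q ^ (s + 1) - 1) * (Q ^ Suc e - 1)"
  proof -
    have a: "(Q ^ s - 1) * Q \<le> (Q ^ s - 1) * Q ^ Suc e" using g1 by (intro mult_left_mono) auto
    have b: "(Q ^ (s + 1) - 1) * (Q ^ Suc e - 1)
        = Q * (Q ^ s * Q ^ Suc e) - Q ^ s * Q - Q ^ Suc e + 1" by (simp add: algebra_simps)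
    have "Q ^ s * Q ^ Suc e \<ge> 1" using Q2 by (simp add: one_le_power flip: power_add power_Suc)
    then have "(Q ^ s * Q ^ Suc e - 1) * (Q - 2) \<ge> 0" using Q2 by (intro mult_nonneg_nonneg) auto
    then have c: "2 * (Q ^ s * Q ^ Suc e) + Q \<le> Q * (Q ^ s * Q ^ Suc e) + 2"
      by (simp add: algebra_simps)
    have d: "Q ^ (s + Suc e) = Q ^ s * Q ^ Suc e" by (rule power_add)
    have a': "Q ^ s * Q - Q \<le> Q ^ s * Q ^ Suc e - Q ^ Suc e" using a by (simp only: left_diff_distrib mult_1)
    show ?thesis unfolding b d using a' c by (simp add: mult.commute)
  qed
  then have "(Q ^ (s + Suc e) - 1) / (Q ^ Suc e - 1) \<le> Q ^ (s + 1) - 1"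
    using p by (simp add: divide_le_eq)
  then have "gauss Q (s + Suc e) s \<le> (Q ^ (s + 1) - 1) * (Q ^ (s + 1) - 1) ^ e"
    unfolding gauss_upper_Suc using Suc gauss_nonneg pow_gt_1[of "s+1"]
    by (intro mult_mono) auto
  then show ?case by simp
qed

text \<open>
  Every quotient \<open>(Q ^ (c + j) - 1) / (Q ^ j - 1)\<close> is at least \<open>Q ^ c\<close>. Here \<open>c\<close> is the
  codimension of the counted spaces, and \<open>y\<close> the number of additional dimensions of the
  space that they are required to contain.
\<close>

lemma gauss_ratio: "Q ^ (c * y) * gauss Q (s + c) s \<le> gauss Q (s + y + c) (s + y)"
proof (induction y)
  case (Suc y)
  define u where "u = s + y"
  have p: "Q ^ Suc u - 1 > 0" using pow_gt_1[of "Suc u"] by simp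
  have "Q ^ c * (Q ^ Suc u - 1) \<le> Q ^ Suc (u + c) - 1"
    using Q2 one_le_power[of Q c] by (simp add: algebra_simps power_add)
  then have "Q ^ c \<le> (Q ^ Suc (u + c) - 1) / (Q ^ Suc u - 1)"
    using p by (simp add: le_divide_eq)
  then have "Q ^ c * (Q ^ (c * y) * gauss Q (s + c) s) \<le> gauss Q (Suc (u + c)) (Suc u)"
    unfolding gauss_Suc
  proof (rule mult_mono)
    show "0 \<le> (Q ^ Suc (u + c) - 1) / (Q ^ Suc u - 1)"
      using \<open>Q ^ c \<le> _\<close> Q2 by (smt (verit) zero_le_power)
  qed (use Suc gauss_nonneg Q2 in \<open>auto simp: u_def\<close>)
  then show ?case by (simp add: power_add u_def algebra_simps)
qed simp

end

section \<open>Counting subspaces over a finite field\<close>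

text \<open>
  The basis is a parameter only because \<open>finite_dimensional_vector_space\<close> has it as one.
\<close>

locale finite_field_space = finite_dimensional_vector_space scale Basis
  for scale :: "'a::{field,finite} \<Rightarrow> 'b::ab_group_add \<Rightarrow> 'b" and Basis :: "'b set" +
  fixes q :: nat
  assumes card_field: "card (UNIV :: 'a set) = q"
begin

abbreviation Q :: real where "Q \<equiv> real q"

lemma Q_ge_2: "Q \<ge> 2"
proof -
  have "card {0, 1 :: 'a} \<le> card (UNIV :: 'a set)" by (rule card_mono) auto
  then show ?thesis using card_field by simp
qed

lemma card_span_independent:
  assumes "finite B" "independent B"
  shows "finite (span B) \<and> card (span B) = q ^ card B"
  using assms
proof (induction B)
  case (insert v B)
  have v: "v \<notin> span B" and B: "independent B" using insert by (auto simp: independent_insert)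
  have span: "span (insert v B) = (\<lambda>(c, x). scale c v + x) ` (UNIV \<times> span B)"
  proof (intro set_eqI iffI)
    fix x assume "x \<in> span (insert v B)"
    then obtain c where "x - scale c v \<in> span B" by (auto simp: span_insert)
    then show "x \<in> (\<lambda>(c, x). scale c v + x) ` (UNIV \<times> span B)"
      by (intro image_eqI[of _ _ "(c, x - scale c v)"]) auto
  next
    fix x assume "x \<in> (\<lambda>(c, x). scale c v + x) ` (UNIV \<times> span B)"
    then obtain c y where "x = scale c v + y" "y \<in> span B" by auto
    then show "x \<in> span (insert v B)" unfolding span_insert by (intro CollectI exI[of _ c]) simp
  qed
  have inj: "inj_on (\<lambda>(c, x). scale c v + x) (UNIV \<times> span B)"
  proof (rule inj_onI, clarsimp)
    fix c x d y assume xy: "x \<in> span B" "y \<in> span B" and eq: "scale c v + x = scale d v + y"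
    have "scale (c - d) v = y - x"
      using eq by (simp add: scale_left_diff_distrib algebra_simps)
    then have m: "scale (c - d) v \<in> span B" using xy by (simp add: span_diff)
    have "c = d"
    proof (rule ccontr)
      assume "c \<noteq> d"
      have "scale (inverse (c - d)) (scale (c - d) v) \<in> span B" by (rule span_scale[OF m])
      then show False using v \<open>c \<noteq> d\<close> by simp
    qed
    then show "c = d \<and> x = y" using eq by simp
  qed
  have "finite (span B)" and c: "card (span B) = q ^ card B"
    using insert.IH B by auto
  then show ?case
    unfolding span using inj insert.hyps by (simp add: card_image card_cartesian_product card_field)
qed simp

lemma card_subspace:
  assumes "subspace W"
  shows "finite W" "card W = q ^ dim W"
proof -
  obtain B where "finite B" "independent B" "span B = W" "card B = dim W"
    using basis_subspace_exists[OF assms] by metis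
  then show "finite W" "card W = q ^ dim W"
    using card_span_independent[of B] by auto
qed

lemma finite_vectors [simp]: "finite (A :: 'b set)"
  by (rule finite_subset[OF subset_UNIV card_subspace(1)[OF subspace_UNIV]])

lemma finite_vector_sets [simp]: "finite (\<S> :: 'b set set)"
proof (rule finite_subset)
  show "finite (Pow (UNIV :: 'b set))" unfolding finite_Pow_iff by (rule finite_vectors)
qed auto

lemma dim_span_Un:
  assumes "subspace S" "subspace T"
  shows "dim (span (S \<union> T)) + dim (S \<inter> T) = dim S + dim T"
proof -
  have "span (S \<union> T) = {x + y |x y. x \<in> S \<and> y \<in> T}"
    unfolding span_Un using assms by (simp add: span_eq_iff[THEN iffD2])
  then show ?thesis using dim_sums_Int[OF assms] by simp
qed

definition between :: "nat \<Rightarrow> 'b set \<Rightarrow> 'b set \<Rightarrow> 'b set set" where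
  "between k T W = {F. subspace F \<and> dim F = k \<and> T \<subseteq> F \<and> F \<subseteq> W}"

text \<open>
  Count the pairs of a space \<open>F\<close> in \<open>between k T W\<close> and a vector of \<open>F\<close> outside \<open>T\<close>: adding the
  vector to \<open>T\<close> raises the dimension by one, which is the recursion of the Gaussian binomial
  coefficients.
\<close>

lemma card_between:
  assumes "subspace T" "subspace W" "T \<subseteq> W" "dim T \<le> k"
  shows "real (card (between k T W)) = gauss Q (dim W - dim T) (k - dim T)"
  using assms
proof (induction "k - dim T" arbitrary: T)
  case 0
  then have k: "k = dim T" by simp
  have "between k T W = {T}"
    unfolding between_def k
  proof (intro set_eqI iffI)
    fix F assume "F \<in> {F. subspace F \<and> dim F = dim T \<and> T \<subseteq> F \<and> F \<subseteq> W}"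
    then have "T = F" using 0 by (intro subspace_dim_equal) auto
    then show "F \<in> {T}" by simp
  qed (use 0 in simp)
  then show ?case using 0 by simp
next
  case (Suc d)
  note sub = \<open>subspace T\<close> \<open>subspace W\<close>
  have card_Diff: "real (card (U - T)) = Q ^ dim U - Q ^ dim T" if "subspace U" "T \<subseteq> U" for U
  proof -
    have "card U \<ge> card T" using that by (intro card_mono) auto
    then show ?thesis
      using card_Diff_subset[of T U] card_subspace(2)[OF that(1)] card_subspace(2)[OF sub(1)] that(2)
      by (simp add: of_nat_diff)
  qed
  have step: "real (card (between k (span (insert v T)) W)) = gauss Q (dim W - Suc (dim T)) d"
    if v: "v \<in> W - T" for v
  proof -
    have span: "span T = T" using sub by simp
    have dim: "dim (span (insert v T)) = Suc (dim T)"
      using v by (simp add: dim_insert span)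
    have "span (insert v T) \<subseteq> W"
      using v Suc.prems by (intro span_minimal) auto
    then have "real (card (between k (span (insert v T)) W))
        = gauss Q (dim W - dim (span (insert v T))) (k - dim (span (insert v T)))"
      using Suc.hyps(2) Suc.prems dim by (intro Suc.hyps(1)) auto
    moreover have "k - dim (span (insert v T)) = d" using dim Suc.hyps(2) by simp
    ultimately show ?thesis using dim by simp
  qed
  have eq: "between k (span (insert v T)) W = {F \<in> between k T W. v \<in> F}" for v
  proof -
    have "span (insert v T) \<subseteq> F \<longleftrightarrow> v \<in> F \<and> T \<subseteq> F" if "subspace F" for F
      using that span_superset[of "insert v T"] span_minimal[of "insert v T" F] by blast
    then show ?thesis unfolding between_def by (auto simp del: span_breakdown_eq)
  qed
  have "(Q ^ k - Q ^ dim T) * real (card (between k T W))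
      = (\<Sum>F\<in>between k T W. real (card (F - T)))"
    using card_Diff by (simp add: between_def)
  also have "\<dots> = (\<Sum>F\<in>between k T W. \<Sum>v | v \<in> W - T \<and> v \<in> F. 1)"
  proof (rule sum.cong[OF refl])
    fix F assume "F \<in> between k T W"
    then have "{v. v \<in> W - T \<and> v \<in> F} = F - T" by (auto simp: between_def)
    then show "real (card (F - T)) = (\<Sum>v | v \<in> W - T \<and> v \<in> F. 1)" by simp
  qed
  also have "\<dots> = (\<Sum>v\<in>W - T. \<Sum>F | F \<in> between k T W \<and> v \<in> F. 1)"
    by (rule sum.swap_restrict) auto
  also have "\<dots> = (\<Sum>v\<in>W - T. real (card (between k (span (insert v T)) W)))"
    by (simp add: eq)
  also have "\<dots> = (Q ^ dim W - Q ^ dim T) * gauss Q (dim W - Suc (dim T)) d"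
    using step card_Diff[OF sub(2) \<open>T \<subseteq> W\<close>] by simp
  finally have count: "(Q ^ k - Q ^ dim T) * real (card (between k T W))
      = (Q ^ dim W - Q ^ dim T) * gauss Q (dim W - Suc (dim T)) d" .
  have k: "k = dim T + Suc d" using Suc by simp
  have f: "Q ^ (dim T + j) - Q ^ dim T = Q ^ dim T * (Q ^ j - 1)" for j
    by (simp add: power_add algebra_simps)
  have Q0: "Q ^ dim T > 0" using Q_ge_2 by simp
  have Qd: "Q ^ Suc d - 1 > 0" using pow_gt_1[OF Q_ge_2, of "Suc d"] by simp
  have le: "dim T \<le> dim W" using Suc.prems by (simp add: dim_subset)
  show ?case
  proof (cases "dim W = dim T")
    case True
    have "Q ^ dim T * (Q ^ Suc d - 1) * real (card (between k T W)) = 0"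
      using count unfolding k f True by simp
    then have "real (card (between k T W)) = 0"
      using Q0 Qd by (metis less_irrefl mult_eq_0_iff)
    then show ?thesis using True by (simp add: k gauss_eq_0)
  next
    case False
    then obtain e where e: "dim W = dim T + Suc e"
      using le less_imp_Suc_add[of "dim T" "dim W"] by auto
    have "(Q ^ Suc d - 1) * real (card (between k T W)) = (Q ^ Suc e - 1) * gauss Q e d"
      using count Q0 Q_ge_2 unfolding k e f by simp
    then have "real (card (between k T W)) = (Q ^ Suc e - 1) * gauss Q e d / (Q ^ Suc d - 1)"
      using Qd by (simp add: eq_divide_eq mult.commute)
    then show ?thesis by (simp add: k e gauss_Suc)
  qed
qed

lemma card_grassmannian_above:
  assumes "subspace T" "dim T \<le> k"
  shows "real (card {F \<in> grassmannian k. T \<subseteq> F}) = gauss Q (dimension - dim T) (k - dim T)"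
proof -
  have "{F \<in> grassmannian k. T \<subseteq> F} = between k T UNIV"
    by (auto simp: grassmannian_def between_def)
  then show ?thesis
    using card_between[OF assms(1) subspace_UNIV _ assms(2)] by (simp add: dimension_def)
qed

text \<open>
  The basic gain: compared with a \<open>t\<close>-space, prescribing a larger space \<open>W\<close> costs a family of
  \<open>k\<close>-spaces a factor \<open>q ^ (n - k)\<close> for every additional dimension.
\<close>

lemma card_above_le:
  assumes H: "\<H> \<subseteq> grassmannian k" and W: "subspace W" "t \<le> dim W" and tk: "t \<le> k" "k \<le> dimension"
  shows "real (card {F \<in> \<H>. W \<subseteq> F})
    \<le> Q powi (- (int (dimension - k) * int (dim W - t))) * gauss Q (dimension - t) (k - t)"
proof (cases "dim W \<le> k")
  case True
  define c y s where "c = dimension - k" and "y = dim W - t" and "s = k - dim W"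
  have "real (card {F \<in> \<H>. W \<subseteq> F}) \<le> real (card {F \<in> grassmannian k. W \<subseteq> F})"
    using H by (auto intro!: card_mono)
  also have "\<dots> = gauss Q (s + c) s"
    using card_grassmannian_above[OF W(1) True] True tk by (simp add: c_def s_def)
  also have "Q ^ (c * y) * gauss Q (s + c) s \<le> gauss Q (dimension - t) (k - t)"
    using gauss_ratio[OF Q_ge_2, of c y s] W True tk by (simp add: c_def s_def y_def)
  then have "gauss Q (s + c) s \<le> Q powi (- (int c * int y)) * gauss Q (dimension - t) (k - t)"
    using Q_ge_2 by (simp add: power_int_minus field_simps flip: of_nat_mult)
  finally show ?thesis by (simp add: c_def y_def)
next
  case False
  then have empty: "{F \<in> \<H>. W \<subseteq> F} = {}"
    using H by (auto simp: grassmannian_def dest: dim_subset)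
  show ?thesis unfolding empty using gauss_nonneg[OF Q_ge_2] Q_ge_2 by simp
qed

text \<open>
  The basic loss: spaces that contain \<open>S\<close> and meet \<open>M\<close> in dimension \<open>d\<close> contain \<open>S + U\<close> for
  one of the \<open>d\<close>-spaces \<open>U\<close> between \<open>S \<inter> M\<close> and \<open>M\<close>. The bound \<open>B\<close> for the spaces that contain
  a given \<open>S + U\<close> is left open, so that the step can be iterated.
\<close>

lemma card_meeting_le:
  assumes H: "\<And>F. F \<in> \<H> \<Longrightarrow> subspace F \<and> S \<subseteq> F \<and> d \<le> dim (F \<inter> M)"
    and S: "subspace S" and M: "subspace M" and d: "dim (S \<inter> M) \<le> d"
    and bound: "\<And>W. subspace W \<Longrightarrow> S \<subseteq> W \<Longrightarrow> W \<subseteq> span (S \<union> M) \<Longrightarrow> dim W = dim S + (d - dim (S \<inter> M))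
        \<Longrightarrow> real (card {F \<in> \<H>. W \<subseteq> F}) \<le> B"
  shows "real (card \<H>) \<le> gauss Q (dim M - dim (S \<inter> M)) (d - dim (S \<inter> M)) * B"
proof -
  define \<U> where "\<U> = between d (S \<inter> M) M"
  have SM: "subspace (S \<inter> M)" using S M by (rule subspace_inter)
  have "\<H> \<subseteq> (\<Union>U\<in>\<U>. {F \<in> \<H>. span (S \<union> U) \<subseteq> F})"
  proof
    fix F assume F: "F \<in> \<H>"
    have FM: "subspace (F \<inter> M)" "S \<inter> M \<subseteq> F \<inter> M" using H[OF F] M by (auto intro: subspace_inter)
    have "real (card (between d (S \<inter> M) (F \<inter> M))) > 0"
      using H[OF F] d card_between[OF SM FM d] gauss_pos[OF Q_ge_2] by (simp add: diff_le_mono)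
    then have "between d (S \<inter> M) (F \<inter> M) \<noteq> {}" by auto
    then obtain U where U: "U \<in> between d (S \<inter> M) (F \<inter> M)" by blast
    then have "U \<in> \<U>" by (auto simp: \<U>_def between_def)
    moreover have "span (S \<union> U) \<subseteq> F"
      using H[OF F] U by (intro span_minimal) (auto simp: between_def)
    ultimately show "F \<in> (\<Union>U\<in>\<U>. {F \<in> \<H>. span (S \<union> U) \<subseteq> F})" using F by blast
  qed
  then have "card \<H> \<le> card (\<Union>U\<in>\<U>. {F \<in> \<H>. span (S \<union> U) \<subseteq> F})" by (intro card_mono) auto
  also have "\<dots> \<le> (\<Sum>U\<in>\<U>. card {F \<in> \<H>. span (S \<union> U) \<subseteq> F})" by (intro card_UN_le) auto
  finally have "real (card \<H>) \<le> (\<Sum>U\<in>\<U>. real (card {F \<in> \<H>. span (S \<union> U) \<subseteq> F}))"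
    by (simp flip: of_nat_sum)
  also have "\<dots> \<le> (\<Sum>U\<in>\<U>. B)"
  proof (rule sum_mono)
    fix U assume "U \<in> \<U>"
    then have U: "subspace U" "dim U = d" "S \<inter> U = S \<inter> M" "U \<subseteq> M" by (auto simp: \<U>_def between_def)
    have "dim (span (S \<union> U)) = dim S + (d - dim (S \<inter> M))"
      using dim_span_Un[OF S U(1)] U d by simp
    then show "real (card {F \<in> \<H>. span (S \<union> U) \<subseteq> F}) \<le> B"
      using U(4) span_superset[of "S \<union> U"] by (intro bound span_mono) auto
  qed
  also have "\<dots> = gauss Q (dim M - dim (S \<inter> M)) (d - dim (S \<inter> M)) * B"
    using card_between[OF SM M _ d] by (simp add: \<U>_def)
  finally show ?thesis .
qed

text \<open>
  The net effect of loss and gain, relative to the number of \<open>k\<close>-spaces through a \<open>t\<close>-space,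
  when \<open>M\<close> exceeds the prescribed dimension \<open>d\<close> by \<open>e\<close>.
\<close>

lemma card_meeting_le_powi:
  assumes H: "\<H> \<subseteq> grassmannian k" "t \<le> k" "k \<le> dimension"
    and meet: "\<And>F. F \<in> \<H> \<Longrightarrow> S \<subseteq> F \<and> d \<le> dim (F \<inter> M)"
    and S: "subspace S" and M: "subspace M" "dim M = d + e"
    and z: "dim (S \<inter> M) = z" "z \<le> d" "t + z \<le> dim S + d"
  shows "real (card \<H>) \<le> Q powi (int (d - z + 1) * int e - int (dim S + d - z - t) * int (dimension - k))
    * gauss Q (dimension - t) (k - t)"
proof -
  define w where "w = dim S + d - z - t"
  have "real (card \<H>) \<le> gauss Q (dim M - dim (S \<inter> M)) (d - dim (S \<inter> M))
      * (Q powi (- (int (dimension - k) * int w)) * gauss Q (dimension - t) (k - t))"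
  proof (rule card_meeting_le)
    fix F assume "F \<in> \<H>"
    then show "subspace F \<and> S \<subseteq> F \<and> d \<le> dim (F \<inter> M)"
      using meet H(1) by (auto simp: grassmannian_def)
  next
    fix W assume W: "subspace W" "dim W = dim S + (d - dim (S \<inter> M))"
    have "t \<le> dim W" "dim W - t = w" using W(2) z by (simp_all add: w_def)
    then show "real (card {F \<in> \<H>. W \<subseteq> F})
        \<le> Q powi (- (int (dimension - k) * int w)) * gauss Q (dimension - t) (k - t)"
      using card_above_le[OF H(1) W(1), of t] H by simp
  qed (use S M z in simp_all)
  also have "gauss Q (dim M - dim (S \<inter> M)) (d - dim (S \<inter> M)) \<le> Q ^ ((d - z + 1) * e)"
  proof -
    have "gauss Q ((d - z) + e) (d - z) \<le> (Q ^ (d - z + 1) - 1) ^ e"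
      by (rule gauss_le_minus_power[OF Q_ge_2])
    also have "\<dots> \<le> (Q ^ (d - z + 1)) ^ e"
      using pow_gt_1[OF Q_ge_2, of "d - z + 1"] by (intro power_mono) auto
    also have "\<dots> = Q ^ ((d - z + 1) * e)" by (rule power_mult[symmetric])
    finally show ?thesis using M(2) z by simp
  qed
  also have "Q ^ ((d - z + 1) * e)
      * (Q powi (- (int (dimension - k) * int w)) * gauss Q (dimension - t) (k - t))
    = Q powi (int (d - z + 1) * int e - int w * int (dimension - k)) * gauss Q (dimension - t) (k - t)"
  proof -
    have "int (d - z + 1) * int e - int w * int (dimension - k)
        = int (d - z + 1) * int e + - (int (dimension - k) * int w)"
      by (simp only: mult.commute diff_conv_add_uminus)
    then have "Q powi (int (d - z + 1) * int e - int w * int (dimension - k))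
        = Q powi (int (d - z + 1) * int e) * Q powi (- (int (dimension - k) * int w))"
      using Q_ge_2 by (simp only:) (intro power_int_add, simp)
    moreover have "Q ^ ((d - z + 1) * e) = Q powi (int (d - z + 1) * int e)"
      by (simp only: of_nat_mult[symmetric] power_int_of_nat)
    ultimately show ?thesis by simp
  qed
  finally show ?thesis
    using gauss_nonneg[OF Q_ge_2] by (simp add: w_def mult_right_mono)
qed

text \<open>
  Let \<open>M\<close> be the intersection of all \<open>F i\<close>, and \<open>A j\<close> the intersection with \<open>F j\<close> left out.
  Modulo \<open>M\<close> the spaces \<open>A j\<close> are independent, because those with \<open>j \<noteq> i\<close> lie in \<open>F i\<close>, which
  meets \<open>A i\<close> in \<open>M\<close> only; for \<open>j \<in> L\<close> they all lie in the intersection over \<open>R - L\<close>. With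
  \<open>L = R - {i}\<close> the sum of the dimensions by which the \<open>A j\<close> exceed \<open>M\<close> is thus at most
  \<open>dim (F i) - dim M\<close>.
\<close>

lemma sum_dim_defects_le:
  assumes R: "finite R" and F: "\<And>i. i \<in> R \<Longrightarrow> subspace (F i)" and "L \<subseteq> R"
  shows "(\<Sum>j\<in>L. dim (\<Inter>i\<in>R - {j}. F i) - dim (\<Inter>i\<in>R. F i)) + dim (\<Inter>i\<in>R. F i)
    \<le> dim (\<Inter>i\<in>R - L. F i)"
proof -
  have "finite L" using assms finite_subset by blast
  then show ?thesis
    using \<open>L \<subseteq> R\<close>
  proof (induction L)
    case (insert j L)
    let ?M = "\<Inter>i\<in>R. F i" and ?A = "\<Inter>i\<in>R - {j}. F i" and ?D = "\<Inter>i\<in>R - L. F i"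
    have sub: "subspace ?A" "subspace ?D" using F by (auto intro!: subspace_Int)
    have Int: "?A \<inter> ?D = ?M" using insert by (auto simp: set_eq_iff)
    have "subspace (\<Inter>i\<in>R - insert j L. F i)" using F by (auto intro!: subspace_Int)
    then have "span (?A \<union> ?D) \<subseteq> (\<Inter>i\<in>R - insert j L. F i)"
      by (intro span_minimal) auto
    then have "dim (span (?A \<union> ?D)) \<le> dim (\<Inter>i\<in>R - insert j L. F i)" by (rule dim_subset)
    moreover have "dim (span (?A \<union> ?D)) + dim ?M = dim ?A + dim ?D"
      using dim_span_Un[OF sub] Int by simp
    moreover have "dim ?M \<le> dim ?A" by (rule dim_subset) auto
    ultimately show ?case using insert by simp
  qed simp
qed

end

section \<open>Cross-intersecting families with a large product\<close>

lemma prod_powi: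
  fixes Q :: real
  assumes "Q \<noteq> 0"
  shows "(\<Prod>i\<in>R. Q powi x i) = Q powi (\<Sum>i\<in>R. x i)"
  by (induction R rule: infinite_finite_induct) (use assms in \<open>auto simp: power_int_add\<close>)

text \<open>
  The next two lemmas evaluate the exponents of two product estimates at a transversal whose
  intersection has the large dimension \<open>s\<close>. There are \<open>r = m + 2\<close> families, \<open>C\<close> is a sum of
  codimensions and \<open>E\<close> the sum of the dimensions by which the intersections with one member
  left out exceed \<open>s\<close>. In both cases the worst case is that \<open>C\<close> is as small and \<open>E\<close> as large
  as allowed and \<open>c = s + 1\<close>; there the threshold on \<open>n\<close> is exactly strong enough to cancel
  the terms of highest degree.
\<close>

lemma exponent_bound_all:
  fixes m n t c s E C :: int
  assumes m: "m \<ge> 1" and t: "t \<ge> 1" and s: "s \<ge> t + 1" and c: "c \<le> s + 1"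
    and n: "n + (m + 2) * t + m + 1 \<le> (m + 2) * c"
    and E: "m * E \<le> (m + 1) * (n - s) - C" and C: "C \<ge> (m + 1) * c"
  shows "(s + 1) * E - (s - t) * C + t * (s - t + 1) \<le> - (t + 2)"
proof -
  define X where "X = (s + 1) * E - (s - t) * C + t * (s - t + 1)"
  have 1: "(s + 1) * (m * E) \<le> (s + 1) * ((m + 1) * (n - s) - C)"
    using E s t by (intro mult_left_mono) auto
  have "0 \<le> m * (s - t)" using s m by simp
  then have 2: "((s + 1) + m * (s - t)) * ((m + 1) * c) \<le> ((s + 1) + m * (s - t)) * C"
    using C s t by (intro mult_left_mono) auto
  have 3: "((s + 1) * (m + 1)) * (n + (m + 2) * t + m + 1) \<le> ((s + 1) * (m + 1)) * ((m + 2) * c)"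
    using n s t m by (intro mult_left_mono) auto
  (* Once n, E and C are eliminated, this is the coefficient of c times the slack in c \<le> s + 1. *)
  have 4: "0 \<le> ((m + 1) * (s + 1 + m + m * t)) * (s + 1 - c)"
    using m s t c by (intro mult_nonneg_nonneg) auto
  have 5: "0 \<le> t * (m * (s - t - 1))" "0 \<le> (m * (t - 1)) * (2 * t + 3)" "0 \<le> t * (s + 1)"
    using m s t by auto
  have "m * X \<le> m * (- (t + 2))"
    using 1 2 3 4 5 m unfolding X_def by (simp add: algebra_simps)
  then show ?thesis unfolding X_def using m by simp
qed

lemma exponent_bound_fixed:
  fixes m n t c s z E C :: int
  assumes m: "m \<ge> 1" and t: "t \<ge> 1" and s: "s \<ge> t + 1" and z: "0 \<le> z" "z \<le> t - 1" and c: "c \<le> s + 1"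
    and n: "n + (m + 2) * t + m + 1 \<le> (m + 2) * c"
    and E: "E \<le> n - c - s" and C: "C \<ge> m * c"
  shows "(s - z + 1) * E - (s - z) * C \<le> - (m + 2)"
proof -
  have 1: "(s - z + 1) * E \<le> (s - z + 1) * (n - c - s)"
    using E s z t by (intro mult_left_mono) auto
  have 2: "(s - z) * (m * c) \<le> (s - z) * C"
    using C s z t by (intro mult_left_mono) auto
  have 3: "(s - z + 1) * (n + (m + 2) * t + m + 1) \<le> (s - z + 1) * ((m + 2) * c)"
    using n s z t by (intro mult_left_mono) auto
  (* Again the remaining coefficient of c times the slack in c \<le> s + 1. *)
  have 4: "0 \<le> (s - z + m + 1) * (s + 1 - c)"
    using m s z t c by (intro mult_nonneg_nonneg) auto
  have 5: "0 \<le> ((m + 2) * t) * (s - z - 2)" "0 \<le> m * (t - 1 - z)" "0 \<le> m * t"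
    using m s z t by auto
  have "(s - z + 1) * E - (s - z) * C \<le> - (2 * (m * t)) - m - 6 * t"
    using 1 2 3 4 5(1,2) by (simp add: algebra_simps)
  then show ?thesis
    using 5(3) m t by linarith
qed

context finite_field_space
begin

text \<open>
  In a transversal whose intersection has the least dimension, exchanging one member cannot
  lower that dimension. So every \<open>X\<close> in \<open>G i\<close> meets the intersection of the other members in
  at least that dimension: a single transversal bounds all the families at once.
\<close>

lemma minimal_transversal:
  assumes ne: "\<And>i. i \<in> R \<Longrightarrow> G i \<noteq> {}"
  obtains F where "\<And>i. i \<in> R \<Longrightarrow> F i \<in> G i"
    and "\<And>i X. i \<in> R \<Longrightarrow> X \<in> G i \<Longrightarrow> dim (\<Inter>j\<in>R. F j) \<le> dim (X \<inter> (\<Inter>j\<in>R - {i}. F j))"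
proof -
  let ?P = "\<lambda>F. \<forall>i\<in>R. F i \<in> G i"
  have "?P (\<lambda>i. SOME X. X \<in> G i)" using ne by (simp add: some_in_eq)
  from ex_has_least_nat[of ?P, OF this, of "\<lambda>F. dim (\<Inter>j\<in>R. F j)"]
  obtain F where F: "?P F"
    and min: "\<And>F'. ?P F' \<Longrightarrow> dim (\<Inter>j\<in>R. F j) \<le> dim (\<Inter>j\<in>R. F' j)"
    by blast
  have "dim (\<Inter>j\<in>R. F j) \<le> dim (X \<inter> (\<Inter>j\<in>R - {i}. F j))" if "i \<in> R" "X \<in> G i" for i X
  proof -
    have "(\<Inter>j\<in>R. (F(i := X)) j) = X \<inter> (\<Inter>j\<in>R - {i}. F j)"
      using \<open>i \<in> R\<close> by (auto split: if_splits)
    moreover have "dim (\<Inter>j\<in>R. F j) \<le> dim (\<Inter>j\<in>R. (F(i := X)) j)"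
      using F that by (intro min) auto
    ultimately show ?thesis by simp
  qed
  then show ?thesis using that F by blast
qed

end

text \<open>
  Here \<open>c\<close> is a lower bound for the codimensions of the members, and \<open>threshold\<close> is the
  hypothesis \<open>n \<ge> r / (r - 1) * (k + t) + 1\<close> for \<open>c = n - k\<close>, freed of denominators. The
  assumption \<open>heavy\<close> says that the product of the sizes reaches the value to be shown
  maximal, so that the extremal structure has to be derived in this locale.
\<close>

locale cross_families = finite_field_space scale Basis q
  for scale :: "'a::{field,finite} \<Rightarrow> 'b::ab_group_add \<Rightarrow> 'b" and Basis :: "'b set" and q :: nat +
  fixes I :: "'i set" and r t c :: nat and k :: "'i \<Rightarrow> nat" and \<F> :: "'i \<Rightarrow> 'b set set"
  assumes finite_I: "finite I" and card_I: "card I = r" and r: "3 \<le> r" and t: "1 \<le> t"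
    and t_le_k: "i \<in> I \<Longrightarrow> t \<le> k i"
    and k_le: "i \<in> I \<Longrightarrow> k i + c \<le> dimension"
    and threshold: "dimension + r * t + (r - 1) \<le> r * c"
    and members: "i \<in> I \<Longrightarrow> \<F> i \<subseteq> grassmannian (k i)"
    and cross: "(\<And>i. i \<in> I \<Longrightarrow> F i \<in> \<F> i) \<Longrightarrow> t \<le> dim (\<Inter>i\<in>I. F i)"
    and heavy: "(\<Prod>i\<in>I. gauss Q (dimension - t) (k i - t)) \<le> (\<Prod>i\<in>I. real (card (\<F> i)))"
begin

abbreviation star :: "'i \<Rightarrow> real" where "star i \<equiv> gauss Q (dimension - t) (k i - t)"
abbreviation codim :: "'i \<Rightarrow> nat" where "codim i \<equiv> dimension - k i"

text \<open>
  The proportion of a family that may be neglected. The estimate in \<open>small_intersection\<close>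
  rules out products above \<open>1 / Q ^ (t + 2)\<close> times the claimed maximum, so \<open>\<epsilon>\<close> must not be
  smaller than that; the comparison in \<open>common_cover\<close> needs \<open>2 * \<epsilon> \<le> 1 / b\<close>, which
  for \<open>Q = 2\<close> leaves no larger choice.
\<close>

definition \<epsilon> :: real where "\<epsilon> = 1 / Q ^ (t + 2)"

text \<open>
  The factor that is gained at every branching step for each new dimension, and also, up to
  the difference between \<open>b\<close> and \<open>b - 1\<close>, the factor that is lost for each dimension by
  which a covering space exceeds \<open>t\<close>.
\<close>

definition b :: real where "b = Q ^ (t + 1)"

lemma subspace_member: "i \<in> I \<Longrightarrow> X \<in> \<F> i \<Longrightarrow> subspace X"
  and dim_member: "i \<in> I \<Longrightarrow> X \<in> \<F> i \<Longrightarrow> dim X = k i"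
  using members by (auto simp: grassmannian_def)

lemma star_pos: "i \<in> I \<Longrightarrow> star i > 0"
  using k_le[of i] by (intro gauss_pos[OF Q_ge_2]) simp

lemma nonempty: "i \<in> I \<Longrightarrow> \<F> i \<noteq> {}"
proof
  assume i: "i \<in> I" "\<F> i = {}"
  then have "(\<Prod>i\<in>I. real (card (\<F> i))) = 0" using finite_I by (auto intro: prod_zero)
  moreover have "(\<Prod>i\<in>I. star i) > 0" using star_pos by (rule prod_pos)
  ultimately show False using heavy by simp
qed

lemma c_le_codim: "i \<in> I \<Longrightarrow> c \<le> codim i"
  using k_le[of i] by simp

lemma c_ge: "t + 2 \<le> c"
proof (rule ccontr)
  assume "\<not> t + 2 \<le> c"
  then have c: "c \<le> t + 1" by simp
  obtain i where "i \<in> I" using r card_I by (metis card.empty equals0I not_numeral_le_zero)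
  then have n: "t + c \<le> dimension" using t_le_k k_le by force
  obtain m where m: "r = Suc m" using r by (cases r) auto
  have "dimension + r * t + m \<le> c + m * c" using threshold m by simp
  moreover have "m * c \<le> m * (t + 1)" using c by (intro mult_le_mono) auto
  ultimately have "t + (t + m * t) + m \<le> m * t + m" using n by (simp add: m algebra_simps)
  then show False using t by simp
qed

lemma cross_Int:
  assumes "p \<in> I" and F: "\<And>i. i \<in> I - {p} \<Longrightarrow> F i \<in> \<F> i" and X: "X \<in> \<F> p"
  shows "t \<le> dim (X \<inter> (\<Inter>i\<in>I - {p}. F i))"
proof -
  have "(\<Inter>i\<in>I. (F(p := X)) i) = X \<inter> (\<Inter>i\<in>I - {p}. F i)"
    using \<open>p \<in> I\<close> by (auto split: if_splits)
  moreover have "t \<le> dim (\<Inter>i\<in>I. (F(p := X)) i)"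
    using F X by (intro cross) auto
  ultimately show ?thesis by simp
qed

text \<open>
  Members of all families except \<open>\<F> p\<close> can be chosen with an intersection of dimension at most
  \<open>codim p - 2\<close>, even if one of them is confined to a subfamily \<open>G\<close> of proportion more than
  \<open>\<epsilon>\<close>. Otherwise take a transversal with the smallest intersection \<open>M\<close>, of dimension \<open>s\<close>. By
  minimality each family is confined to spaces that meet the intersection of the other chosen
  members in dimension at least \<open>s\<close>, and \<open>\<F> p\<close> is confined to spaces that meet \<open>M\<close> in
  dimension at least \<open>t\<close>. The dimensions of these intersections are controlled by
  \<open>sum_dim_defects_le\<close>, and the product of the resulting bounds is at most \<open>\<epsilon>\<close> times the
  claimed maximum, against the assumption that the product is large.
\<close>

lemma small_intersection:
  assumes p: "p \<in> I" and j: "j \<in> I" "j \<noteq> p" and G: "G \<subseteq> \<F> j" "\<epsilon> * real (card (\<F> j)) < real (card G)"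
  obtains F where "\<And>i. i \<in> I - {p} \<Longrightarrow> F i \<in> \<F> i" "F j \<in> G" "dim (\<Inter>i\<in>I - {p}. F i) + 2 \<le> codim p"
proof -
  define R where "R = I - {p}"
  define G' where "G' i = (if i = j then G else \<F> i)" for i
  have R: "finite R" "card R = r - 1" "j \<in> R" "\<And>i. i \<in> R \<Longrightarrow> i \<in> I"
    using finite_I card_I p j by (auto simp: R_def)
  have "\<epsilon> * real (card (\<F> j)) \<ge> 0" by (simp add: \<epsilon>_def)
  then have "G \<noteq> {}" using G by auto
  then have "\<And>i. i \<in> R \<Longrightarrow> G' i \<noteq> {}" using nonempty R by (auto simp: G'_def)
  then obtain F where F: "\<And>i. i \<in> R \<Longrightarrow> F i \<in> G' i"
    and min: "\<And>i X. i \<in> R \<Longrightarrow> X \<in> G' i \<Longrightarrow> dim (\<Inter>j\<in>R. F j) \<le> dim (X \<inter> (\<Inter>j\<in>R - {i}. F j))"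
    using minimal_transversal[of R G'] by blast
  have G'F: "X \<in> \<F> i" if "X \<in> G' i" for X i using that G by (auto simp: G'_def split: if_splits)
  define M where "M = (\<Inter>j\<in>R. F j)"
  define A where "A i = (\<Inter>j\<in>R - {i}. F j)" for i
  define s where "s = dim M"
  have dim_zero: "dim ({0} \<inter> X) = 0" for X by simp
  define e where "e i = dim (A i) - s" for i
  have FF: "F i \<in> \<F> i" if "i \<in> R" for i by (rule G'F[OF F[OF that]])
  have sub: "subspace (F i)" if "i \<in> R" for i by (rule subspace_member[OF R(4)[OF that] FF[OF that]])
  have subM: "subspace M" and subA: "subspace (A i)" for i
    unfolding M_def A_def using sub by (auto intro!: subspace_Int)
  have "dim M + 2 \<le> codim p"
  proof (rule ccontr)
    assume "\<not> dim M + 2 \<le> codim p"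
    then have cs: "c \<le> s + 1" using c_le_codim[OF p] by (simp add: s_def)
    then have st: "t + 1 \<le> s" using c_ge by simp
    have dimA: "dim (A i) = s + e i" for i
    proof -
      have "M \<subseteq> A i" by (auto simp: M_def A_def)
      then show ?thesis using dim_subset by (simp add: e_def s_def)
    qed
    have cardG: "real (card (G' i)) \<le> Q powi (int (s + 1) * int (e i) - int (s - t) * int (codim i)) * star i"
      if i: "i \<in> R" for i
    proof -
      have G'k: "G' i \<subseteq> grassmannian (k i)" using G'F[of _ i] members[OF R(4)[OF i]] by blast
      have meet: "{0} \<subseteq> X \<and> s \<le> dim (X \<inter> A i)" if X: "X \<in> G' i" for X
        using min[OF i X] subspace_member[OF R(4)[OF i] G'F[OF X]] subspace_0[of X]
        by (simp add: s_def M_def A_def)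
      have dim_k: "t \<le> k i" "k i \<le> dimension"
        using t_le_k[OF R(4)[OF i]] k_le[OF R(4)[OF i]] by simp_all
      show ?thesis
        using card_meeting_le_powi[OF G'k dim_k meet subspace_single_0 subA dimA dim_zero le0] st
        by simp
    qed
    have cardp: "real (card (\<F> p)) \<le> Q powi (int t * (int s - int t + 1)) * star p"
    proof -
      have "real (card (\<F> p)) \<le> gauss Q (dim M - dim ({0} \<inter> M)) (t - dim ({0} \<inter> M)) * star p"
      proof (rule card_meeting_le)
        fix X assume X: "X \<in> \<F> p"
        have "t \<le> dim (X \<inter> M)"
          unfolding M_def R_def by (rule cross_Int[OF p _ X]) (use FF in \<open>simp add: R_def\<close>)
        then show "subspace X \<and> {0} \<subseteq> X \<and> t \<le> dim (X \<inter> M)"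
          using subspace_member[OF p X] subspace_0[of X] by simp
      next
        fix W assume W: "subspace W" "dim W = dim {0} + (t - dim ({0} \<inter> M))"
        then have "dim W = t" by (simp only: dim_zero) simp
        then show "real (card {F \<in> \<F> p. W \<subseteq> F}) \<le> star p"
          using card_above_le[OF members[OF p] W(1), of t] t_le_k[OF p] k_le[OF p] by auto
      qed (simp_all only: dim_zero le0 subspace_single_0 subM)
      also have "dim ({0} \<inter> M) = 0" by simp
      also have "gauss Q (dim M - 0) (t - 0) \<le> Q ^ ((s - t + 1) * t)"
        using gauss_le_power[OF Q_ge_2, of "s - t" t] st by (simp add: s_def)
      also have "Q ^ ((s - t + 1) * t) = Q powi (int t * (int s - int t + 1))"
      proof -
        obtain d where "s = t + d" using st le_Suc_ex[of t s] by auto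
        then have "int t * (int s - int t + 1) = int ((s - t + 1) * t)" by (simp add: algebra_simps)
        then show ?thesis by (simp only: power_int_of_nat)
      qed
      finally show ?thesis using star_pos[OF p] by (simp add: mult_right_mono)
    qed
    (* Each e i with i different from j is counted in the bound that F j provides, hence the factor m. *)
    define E where "E = (\<Sum>i\<in>R. int (e i))"
    define C where "C = (\<Sum>i\<in>R. int (codim i))"
    define m where "m = int r - 2"
    have cardR: "int (card R) = m + 1" using R r by (simp add: m_def)
    have "(\<Sum>i\<in>R. E - int (e i)) \<le> (\<Sum>i\<in>R. int dimension - int (codim i) - int s)"
    proof (rule sum_mono)
      fix i assume i: "i \<in> R"
      have "(\<Sum>j\<in>R - {i}. e j) + s \<le> dim (\<Inter>l\<in>R - (R - {i}). F l)"
        using sum_dim_defects_le[of R F "R - {i}"] sub R(1) by (simp add: e_def A_def s_def M_def)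
      also have "R - (R - {i}) = {i}" using i by auto
      finally have "(\<Sum>j\<in>R - {i}. e j) + s \<le> k i"
        using dim_member[OF R(4)[OF i] FF[OF i]] by simp
      then have "int (\<Sum>j\<in>R - {i}. e j) + int s \<le> int (k i)" by linarith
      moreover have "E - int (e i) = int (\<Sum>j\<in>R - {i}. e j)"
        using sum.remove[OF R(1) i, of "\<lambda>i. int (e i)"] by (simp add: E_def)
      ultimately show "E - int (e i) \<le> int dimension - int (codim i) - int s"
        using k_le[OF R(4)[OF i]] by (simp add: of_nat_diff)
    qed
    then have mE: "m * E \<le> (m + 1) * (int dimension - int s) - C"
      unfolding sum_subtractf sum_constant cardR E_def[symmetric] C_def[symmetric]
      by (simp add: algebra_simps)
    have mC: "(m + 1) * int c \<le> C"
    proof -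
      have "(\<Sum>i\<in>R. int c) \<le> C" unfolding C_def using c_le_codim R(4) by (intro sum_mono) force
      then show ?thesis using cardR by simp
    qed
    have "int dimension + (m + 2) * int t + m + 1 \<le> (m + 2) * int c"
    proof -
      have "int (dimension + r * t + (r - 1)) \<le> int (r * c)" using threshold by (simp only: of_nat_le_iff)
      then show ?thesis using r by (simp add: m_def of_nat_diff)
    qed
    then have X: "(int s + 1) * E - (int s - int t) * C + int t * (int s - int t + 1) \<le> - (int t + 2)"
      using r t st cs mE mC by (intro exponent_bound_all[where m = m and c = "int c"]) (auto simp: m_def)
    have prod_split: "(\<Prod>i\<in>I. f i) = f p * (\<Prod>i\<in>R. f i)" for f :: "'i \<Rightarrow> real"
      unfolding R_def by (rule prod.remove[OF finite_I p])
    have prod_split': "(\<Prod>i\<in>R. f i) = f j * (\<Prod>i\<in>R - {j}. f i)" for f :: "'i \<Rightarrow> real"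
      by (rule prod.remove[OF R(1,3)])
    have card_pos: "real (card (\<F> i)) > 0" if "i \<in> I" for i
      using nonempty[OF that] by (simp add: card_gt_0_iff)
    have "\<epsilon> * (\<Prod>i\<in>I. star i) \<le> \<epsilon> * (\<Prod>i\<in>I. real (card (\<F> i)))"
      using heavy by (intro mult_left_mono) (auto simp: \<epsilon>_def)
    also have "\<dots> = (\<epsilon> * real (card (\<F> j))) * (real (card (\<F> p)) * (\<Prod>i\<in>R - {j}. real (card (\<F> i))))"
      unfolding prod_split prod_split' by (simp add: mult_ac)
    also have "\<dots> < real (card G) * (real (card (\<F> p)) * (\<Prod>i\<in>R - {j}. real (card (\<F> i))))"
      using G(2) p R(4) card_pos by (intro mult_strict_right_mono mult_pos_pos prod_pos) auto
    also have "\<dots> = real (card (\<F> p)) * (\<Prod>i\<in>R. real (card (G' i)))"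
      unfolding prod_split' by (simp add: G'_def mult_ac)
    also have "\<dots> \<le> (Q powi (int t * (int s - int t + 1)) * star p) *
        (\<Prod>i\<in>R. Q powi (int (s + 1) * int (e i) - int (s - t) * int (codim i)) * star i)"
      using cardp cardG by (intro mult_mono prod_mono prod_nonneg mult_nonneg_nonneg)
        (auto simp: gauss_nonneg[OF Q_ge_2])
    also have "\<dots> = (Q powi (int t * (int s - int t + 1)) *
        Q powi (\<Sum>i\<in>R. int (s + 1) * int (e i) - int (s - t) * int (codim i))) * (\<Prod>i\<in>I. star i)"
      using Q_ge_2 by (simp add: prod.distrib prod_powi prod_split mult_ac)
    also have "Q powi (int t * (int s - int t + 1)) *
        Q powi (\<Sum>i\<in>R. int (s + 1) * int (e i) - int (s - t) * int (codim i))
       = Q powi ((int s + 1) * E - (int s - int t) * C + int t * (int s - int t + 1))"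
    proof -
      have "(\<Sum>i\<in>R. int (s + 1) * int (e i) - int (s - t) * int (codim i))
          = (int s + 1) * E - (int s - int t) * C"
        using st by (simp add: sum_subtractf E_def C_def of_nat_diff flip: sum_distrib_left)
      then show ?thesis using Q_ge_2 by (simp add: power_int_add mult_ac)
    qed
    also have "\<dots> * (\<Prod>i\<in>I. star i) \<le> \<epsilon> * (\<Prod>i\<in>I. star i)"
    proof (rule mult_right_mono)
      have "Q powi ((int s + 1) * E - (int s - int t) * C + int t * (int s - int t + 1))
          \<le> Q powi (- (int t + 2))"
        using X Q_ge_2 by (intro power_int_increasing) auto
      also have "\<dots> = \<epsilon>"
      proof -
        have "int t + 2 = int (t + 2)" by simp
        then show ?thesis unfolding \<epsilon>_def power_int_minus by (simp only: power_int_of_nat inverse_eq_divide)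
      qed
      finally show "Q powi ((int s + 1) * E - (int s - int t) * C + int t * (int s - int t + 1)) \<le> \<epsilon>" .
    qed (intro prod_nonneg ballI gauss_nonneg[OF Q_ge_2])
    finally show False by simp
  qed
  moreover have "F j \<in> G" using F[OF R(3)] by (simp add: G'_def)
  ultimately show ?thesis
    using that[of F] FF unfolding M_def R_def by blast
qed

end

section \<open>Branching and covering spaces\<close>

context cross_families
begin

lemma \<epsilon>_pos: "\<epsilon> > 0" and \<epsilon>_le: "\<epsilon> \<le> 1 / 8" and two_\<epsilon>_le: "2 * \<epsilon> \<le> 1 / b" and b_ge_4: "b \<ge> 4"
proof -
  have "(2 :: real) ^ 3 \<le> 2 ^ (t + 2)" "(2 :: real) ^ 2 \<le> 2 ^ (t + 1)"
    using t by (intro power_increasing; simp)+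
  moreover have "(2 :: real) ^ (t + 2) \<le> Q ^ (t + 2)" "(2 :: real) ^ (t + 1) \<le> Q ^ (t + 1)"
    using Q_ge_2 by (intro power_mono; simp)+
  ultimately have Qt: "8 \<le> Q ^ (t + 2)" "4 \<le> Q ^ (t + 1)" by simp_all
  show "\<epsilon> > 0" "\<epsilon> \<le> 1 / 8" "b \<ge> 4"
    using Qt by (simp_all add: \<epsilon>_def b_def divide_simps)
  have "Q ^ (t + 2) = Q * b" by (simp add: b_def)
  then show "2 * \<epsilon> \<le> 1 / b" using Q_ge_2 \<open>b \<ge> 4\<close> by (simp add: \<epsilon>_def divide_simps)
qed

lemma card_pos: "i \<in> I \<Longrightarrow> real (card (\<F> i)) > 0"
  using nonempty[of i] by (simp add: card_gt_0_iff)

text \<open>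
  The invariant of the branching process: the spaces of \<open>\<F> p\<close> above a space \<open>W\<close> are as few as
  dimension alone dictates, and still fewer by a factor \<open>b\<close> for every dimension that \<open>W\<close> lacks
  to \<open>D\<close>. For \<open>D \<le> dim W\<close> only the first part is left.
\<close>

lemma card_above_weighted:
  assumes p: "p \<in> I" and W: "subspace W" "t \<le> dim W" "D \<le> dim W"
  shows "real (card {F \<in> \<F> p. W \<subseteq> F}) * b ^ (D - dim W)
    \<le> Q powi (- (int (codim p) * int (dim W - t))) * star p"
  using card_above_le[OF members[OF p] W(1,2) t_le_k[OF p]] k_le[OF p] W(3) by simp

text \<open>
  One branching step. The members of \<open>\<F> p\<close> above \<open>S\<close> meet \<open>M\<close> in dimension \<open>t\<close>, and \<open>S\<close> does not
  yet do so, hence they contain one of the extensions of \<open>S\<close> by \<open>y\<close> dimensions of \<open>M\<close>. There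
  are at most \<open>q ^ ((dim M - t + 1) * y)\<close> of these extensions, while prescribing \<open>y\<close> more
  dimensions gains \<open>q ^ (codim p * y)\<close>. As \<open>dim M + 2 \<le> codim p\<close>, a factor of \<open>b ^ y\<close> remains.
\<close>

lemma card_branch:
  assumes p: "p \<in> I" and S: "subspace S" "t \<le> dim S"
    and M: "subspace M" "dim M + 2 \<le> codim p" "dim (S \<inter> M) < t"
    and meet: "\<And>F. F \<in> \<F> p \<Longrightarrow> t \<le> dim (F \<inter> M)"
    and above: "\<And>W. subspace W \<Longrightarrow> S \<subseteq> W \<Longrightarrow> dim W = dim S + (t - dim (S \<inter> M)) \<Longrightarrow>
      real (card {F \<in> \<F> p. W \<subseteq> F}) * b ^ (D - dim W)
        \<le> Q powi (- (int (codim p) * int (dim W - t))) * star p"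
  shows "real (card {F \<in> \<F> p. S \<subseteq> F}) * b ^ (D - dim S)
    \<le> Q powi (- (int (codim p) * int (dim S - t))) * star p"
proof -
  define y where "y = t - dim (S \<inter> M)"
  define w where "w = dim S + y"
  define B where "B = Q powi (- (int (codim p) * int (w - t))) * star p / b ^ (D - w)"
  have b: "b > 0" using b_ge_4 by simp
  obtain F0 where "F0 \<in> \<F> p" using nonempty[OF p] by blast
  then have "t \<le> dim (F0 \<inter> M)" by (rule meet)
  also have "\<dots> \<le> dim M" by (rule dim_subset) auto
  finally have tM: "t \<le> dim M" .
  have "real (card {F \<in> \<F> p. S \<subseteq> F}) \<le> gauss Q (dim M - dim (S \<inter> M)) y * B"
    unfolding y_def
  proof (rule card_meeting_le)
    fix W assume W: "subspace W" "S \<subseteq> W" "dim W = dim S + (t - dim (S \<inter> M))"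
    have "{F \<in> {F \<in> \<F> p. S \<subseteq> F}. W \<subseteq> F} = {F \<in> \<F> p. W \<subseteq> F}" using W by auto
    then show "real (card {F \<in> {F \<in> \<F> p. S \<subseteq> F}. W \<subseteq> F}) \<le> B"
      using above[OF W] W(3) b by (simp add: B_def w_def y_def le_divide_eq)
  next
    fix F assume "F \<in> {F \<in> \<F> p. S \<subseteq> F}"
    then show "subspace F \<and> S \<subseteq> F \<and> t \<le> dim (F \<inter> M)"
      using meet subspace_member[OF p] by simp
  qed (use S M in simp_all)
  also have "dim M - dim (S \<inter> M) = (dim M - t) + y" using tM M by (simp add: y_def)
  also have "gauss Q ((dim M - t) + y) y * B \<le> Q ^ ((dim M - t + 1) * y) * B"
    using gauss_le_power[OF Q_ge_2, of "dim M - t" y] star_pos[OF p] b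
    by (intro mult_right_mono) (auto simp: B_def)
  finally have "real (card {F \<in> \<F> p. S \<subseteq> F}) * b ^ (D - dim S)
      \<le> Q ^ ((dim M - t + 1) * y) * B * b ^ (D - dim S)"
    using b by (intro mult_right_mono) auto
  also have "\<dots> \<le> Q ^ ((dim M - t + 1) * y) * B * (b ^ (D - w) * b ^ y)"
  proof (rule mult_left_mono)
    have "D - dim S \<le> (D - w) + y" by (simp add: w_def)
    then have "b ^ (D - dim S) \<le> b ^ ((D - w) + y)" using b_ge_4 by (intro power_increasing) auto
    then show "b ^ (D - dim S) \<le> b ^ (D - w) * b ^ y" by (simp only: power_add)
  qed (use star_pos[OF p] b in \<open>auto simp: B_def\<close>)
  also have "\<dots> = Q ^ ((dim M + 2) * y) * Q powi (- (int (codim p) * int (w - t))) * star p"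
  proof -
    have "b ^ y = Q ^ ((t + 1) * y)" unfolding b_def by (rule power_mult[symmetric])
    moreover have "(dim M - t + 1) * y + (t + 1) * y = (dim M + 2) * y"
      unfolding add_mult_distrib[symmetric] using tM by simp
    ultimately have 1: "Q ^ ((dim M - t + 1) * y) * b ^ y = Q ^ ((dim M + 2) * y)"
      by (simp only: power_add[symmetric])
    have 2: "B * b ^ (D - w) = Q powi (- (int (codim p) * int (w - t))) * star p"
      using b by (simp add: B_def)
    have "Q ^ ((dim M - t + 1) * y) * B * (b ^ (D - w) * b ^ y)
        = (Q ^ ((dim M - t + 1) * y) * b ^ y) * (B * b ^ (D - w))" by (simp only: mult_ac)
    then show ?thesis unfolding 1 2 by (simp only: mult.assoc)
  qed
  also have "\<dots> \<le> Q ^ (codim p * y) * Q powi (- (int (codim p) * int (w - t))) * star p"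
    using M(2) Q_ge_2 star_pos[OF p] by (intro mult_right_mono power_increasing mult_le_mono) auto
  also have "Q ^ (codim p * y) * Q powi (- (int (codim p) * int (w - t)))
      = Q powi (- (int (codim p) * int (dim S - t)))"
  proof -
    have "int (w - t) = int (dim S - t) + int y" using S(2) by (simp add: w_def)
    then have "int (codim p * y) + - (int (codim p) * int (w - t)) = - (int (codim p) * int (dim S - t))"
      by (simp only: of_nat_mult) (simp add: algebra_simps)
    then show ?thesis
      using Q_ge_2 power_int_add[of Q "int (codim p * y)" "- (int (codim p) * int (w - t))"]
      by (simp only: power_int_of_nat) simp
  qed
  finally show ?thesis .
qed

text \<open>
  A space covers a family if it meets all members in dimension at least \<open>t\<close>; exceptions are
  admitted because only subfamilies that are not too small can be used in
  \<open>small_intersection\<close>.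
\<close>

definition almost_covers :: "'b set \<Rightarrow> 'i \<Rightarrow> bool" where
  "almost_covers S i \<longleftrightarrow> real (card {F \<in> \<F> i. dim (F \<inter> S) < t}) \<le> \<epsilon> * real (card (\<F> i))"

lemma almost_covers_card:
  assumes "almost_covers S i"
  shows "(1 - \<epsilon>) * real (card (\<F> i)) \<le> real (card {F \<in> \<F> i. t \<le> dim (F \<inter> S)})"
proof -
  have "card (\<F> i) = card ({F \<in> \<F> i. dim (F \<inter> S) < t} \<union> {F \<in> \<F> i. t \<le> dim (F \<inter> S)})"
    by (rule arg_cong[where f = card]) auto
  also have "\<dots> = card {F \<in> \<F> i. dim (F \<inter> S) < t} + card {F \<in> \<F> i. t \<le> dim (F \<inter> S)}"
    by (rule card_Un_disjoint) auto
  finally show ?thesis using assms by (simp add: almost_covers_def left_diff_distrib)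
qed

lemma almost_covers_dim:
  assumes "i \<in> I" "almost_covers S i"
  shows "t \<le> dim S"
proof (rule ccontr)
  assume small: "\<not> t \<le> dim S"
  have "\<not> t \<le> dim (F \<inter> S)" for F using small dim_subset[of "F \<inter> S" S] by simp
  then have "{F \<in> \<F> i. t \<le> dim (F \<inter> S)} = {}" by simp
  then have "(1 - \<epsilon>) * real (card (\<F> i)) \<le> 0" using almost_covers_card[OF assms(2)] by (simp only: card.empty)
  then show False using card_pos[OF assms(1)] \<epsilon>_le by (simp add: mult_le_0_iff)
qed

text \<open>
  If \<open>S\<close> leaves many members of \<open>\<F> j\<close> uncovered, one of them is part of a transversal with a
  small intersection \<open>M\<close>. This \<open>M\<close> is suitable for a branching step at \<open>S\<close>.
\<close>

lemma branching_space:
  assumes p: "p \<in> I" and j: "j \<in> I - {p}" "\<not> almost_covers S j"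
  obtains M where "subspace M" "dim M + 2 \<le> codim p" "dim (S \<inter> M) < t"
    "\<And>F. F \<in> \<F> p \<Longrightarrow> t \<le> dim (F \<inter> M)"
proof -
  define G where "G = {F \<in> \<F> j. dim (F \<inter> S) < t}"
  have "G \<subseteq> \<F> j" "\<epsilon> * real (card (\<F> j)) < real (card G)"
    using j by (auto simp: G_def almost_covers_def)
  with p j obtain F where F: "\<And>i. i \<in> I - {p} \<Longrightarrow> F i \<in> \<F> i" "F j \<in> G"
    and dim: "dim (\<Inter>i\<in>I - {p}. F i) + 2 \<le> codim p"
    using small_intersection[of p j G] by blast
  define M where "M = (\<Inter>i\<in>I - {p}. F i)"
  show ?thesis
  proof (rule that[of M])
    show "subspace M" unfolding M_def
      by (rule subspace_Int) (rule subspace_member[OF _ F(1)], auto)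
    have "S \<inter> M \<subseteq> F j \<inter> S" using j by (auto simp: M_def)
    then have "dim (S \<inter> M) \<le> dim (F j \<inter> S)" by (rule dim_subset)
    then show "dim (S \<inter> M) < t" using F(2) by (simp add: G_def)
    show "t \<le> dim (X \<inter> M)" if "X \<in> \<F> p" for X
      unfolding M_def by (rule cross_Int[OF p F(1) that])
  qed (use dim in \<open>simp add: M_def\<close>)
qed

text \<open>
  Branching continues as long as some other family is not almost covered.
\<close>

lemma card_above_decay:
  assumes p: "p \<in> I"
    and uncovered: "\<And>S. subspace S \<Longrightarrow> T \<subseteq> S \<Longrightarrow> dim S < D \<Longrightarrow> \<exists>j\<in>I - {p}. \<not> almost_covers S j"
    and S: "subspace S" "T \<subseteq> S" "t \<le> dim S"
  shows "real (card {F \<in> \<F> p. S \<subseteq> F}) * b ^ (D - dim S)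
    \<le> Q powi (- (int (codim p) * int (dim S - t))) * star p"
  using S
proof (induction "D - dim S" arbitrary: S rule: less_induct)
  case less
  show ?case
  proof (cases "dim S < D")
    case True
    then obtain j where "j \<in> I - {p}" "\<not> almost_covers S j" using uncovered less.prems by blast
    then obtain M where M: "subspace M" "dim M + 2 \<le> codim p" "dim (S \<inter> M) < t"
      and meet: "\<And>F. F \<in> \<F> p \<Longrightarrow> t \<le> dim (F \<inter> M)"
      using branching_space[OF p] by metis
    show ?thesis
    proof (rule card_branch[OF p less.prems(1,3) M meet])
      fix W assume W: "subspace W" "S \<subseteq> W" "dim W = dim S + (t - dim (S \<inter> M))"
      then show "real (card {F \<in> \<F> p. W \<subseteq> F}) * b ^ (D - dim W)
          \<le> Q powi (- (int (codim p) * int (dim W - t))) * star p"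
        using True M(3) less.prems by (intro less.hyps) auto
    qed
  qed (use card_above_weighted[OF p less.prems(1,3), of D] in simp)
qed

text \<open>
  Almost all members of \<open>\<F> p\<close> contain a \<open>t\<close>-subspace of \<open>C\<close>, of which there are at most
  \<open>(b - 1) ^ x\<close>; from each of them, branching up to dimension \<open>t + y\<close> gains \<open>b ^ y\<close>.
\<close>

lemma card_family_le:
  assumes p: "p \<in> I" and C: "subspace C" "dim C = t + x" "almost_covers C p"
    and uncovered: "\<And>T S. subspace T \<Longrightarrow> T \<subseteq> C \<Longrightarrow> dim T = t \<Longrightarrow> subspace S \<Longrightarrow> T \<subseteq> S \<Longrightarrow> dim S < t + y
      \<Longrightarrow> \<exists>j\<in>I - {p}. \<not> almost_covers S j"
  shows "(1 - \<epsilon>) * real (card (\<F> p)) * b ^ y \<le> (b - 1) ^ x * star p"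
proof -
  have b: "b > 0" using b_ge_4 by simp
  have dim_zero: "dim ({0} \<inter> C) = 0" by simp
  define \<H> where "\<H> = {F \<in> \<F> p. t \<le> dim (F \<inter> C)}"
  have "(1 - \<epsilon>) * real (card (\<F> p)) \<le> real (card \<H>)"
    unfolding \<H>_def by (rule almost_covers_card[OF C(3)])
  also have "\<dots> \<le> gauss Q (dim C - dim ({0} \<inter> C)) (t - dim ({0} \<inter> C)) * (star p / b ^ y)"
  proof (rule card_meeting_le)
    fix F assume "F \<in> \<H>"
    then show "subspace F \<and> {0} \<subseteq> F \<and> t \<le> dim (F \<inter> C)"
      using subspace_member[OF p, of F] subspace_0[of F] by (auto simp: \<H>_def)
  next
    fix W assume W: "subspace W" "W \<subseteq> span ({0} \<union> C)" "dim W = dim {0} + (t - dim ({0} \<inter> C))"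
    have dimW: "dim W = t" using W(3) by (simp only: dim_zero) simp
    have C0: "{0} \<union> C = C" using subspace_0[OF C(1)] by auto
    have span_C: "span C = C" using C(1) by (rule span_eq_iff[THEN iffD2])
    have "W \<subseteq> C" using W(2) unfolding C0 span_C .
    then have "real (card {F \<in> \<F> p. W \<subseteq> F}) * b ^ (t + y - dim W)
        \<le> Q powi (- (int (codim p) * int (dim W - t))) * star p"
      using uncovered[OF W(1) _ dimW] dimW by (intro card_above_decay[OF p _ W(1)]) auto
    then have "real (card {F \<in> \<F> p. W \<subseteq> F}) \<le> star p / b ^ y"
      using dimW b by (simp add: le_divide_eq)
    moreover have "card {F \<in> \<H>. W \<subseteq> F} \<le> card {F \<in> \<F> p. W \<subseteq> F}"
      by (rule card_mono) (auto simp: \<H>_def)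
    ultimately show "real (card {F \<in> \<H>. W \<subseteq> F}) \<le> star p / b ^ y" by linarith
  qed (simp_all only: dim_zero le0 subspace_single_0 C)
  also have "gauss Q (dim C - dim ({0} \<inter> C)) (t - dim ({0} \<inter> C)) = gauss Q (t + x) t"
    by (simp only: dim_zero C diff_zero)
  also have "\<dots> * (star p / b ^ y) \<le> (b - 1) ^ x * (star p / b ^ y)"
    using gauss_le_minus_power[OF Q_ge_2, of t x] star_pos[OF p] b
    by (intro mult_right_mono) (auto simp: b_def)
  finally show ?thesis using b by (simp add: le_divide_eq)
qed

text \<open>
  Let \<open>t + x i\<close> be the least dimension of a space that almost covers \<open>\<F> i\<close>. In
  \<open>card_family_le\<close> the family \<open>\<F> p\<close> loses \<open>(b - 1) ^ x p\<close>, but branching for \<open>\<F> p\<close> goes on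
  until every other family is almost covered, which gains \<open>b ^ y p\<close> for any \<open>y p\<close> of the form
  \<open>x j\<close> with \<open>j \<noteq> p\<close>. Choosing the largest value for \<open>x j\<close> whenever possible, the gains
  outweigh the losses.
  If all \<open>x i\<close> vanish and there is no common space, every family still gains one factor \<open>b\<close>.
\<close>

lemma common_cover:
  obtains T where "subspace T" "dim T = t" "\<And>i. i \<in> I \<Longrightarrow> almost_covers T i"
proof -
  have "\<exists>T. subspace T \<and> dim T = t \<and> (\<forall>i\<in>I. almost_covers T i)"
  proof (rule ccontr)
    assume none: "\<not> (\<exists>T. subspace T \<and> dim T = t \<and> (\<forall>i\<in>I. almost_covers T i))"
    define P where "P i x \<longleftrightarrow> (\<exists>C. subspace C \<and> dim C = t + x \<and> almost_covers C i)" for i x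
    define x where "x i = (LEAST x. P i x)" for i
    have "P i (dimension - t)" if i: "i \<in> I" for i
    proof -
      have "t \<le> dimension" using t_le_k[OF i] k_le[OF i] by simp
      moreover have "{F \<in> \<F> i. dim (F \<inter> UNIV) < t} = {}"
        using dim_member[OF i] t_le_k[OF i] by force
      then have "almost_covers UNIV i" unfolding almost_covers_def using \<epsilon>_pos by (simp only: card.empty) simp
      ultimately show ?thesis unfolding P_def by (intro exI[of _ UNIV]) (auto simp: dimension_def)
    qed
    then have "P i (x i)" if "i \<in> I" for i using LeastI[of "P i"] that by (auto simp: x_def)
    then obtain C where C: "\<And>i. i \<in> I \<Longrightarrow> subspace (C i) \<and> dim (C i) = t + x i \<and> almost_covers (C i) i"
      unfolding P_def by metis
    have x_le: "t + x i \<le> dim S" if "i \<in> I" "subspace S" "almost_covers S i" for i S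
    proof -
      have "t \<le> dim S" using almost_covers_dim that by blast
      then have "P i (dim S - t)" using that unfolding P_def by (intro exI[of _ S]) simp
      then have "x i \<le> dim S - t" unfolding x_def by (rule Least_le)
      then show ?thesis using \<open>t \<le> dim S\<close> by simp
    qed
    (* The gains y outweigh the losses x and are positive for all but at most one family. *)
    have "\<exists>y. (\<Sum>i\<in>I. x i) \<le> (\<Sum>i\<in>I. y i) \<and> r - 1 \<le> (\<Sum>i\<in>I. y i) \<and>
      (\<forall>p\<in>I. (1 - \<epsilon>) * real (card (\<F> p)) * b ^ y p \<le> (b - 1) ^ x p * star p)"
    proof (cases "\<forall>i\<in>I. x i = 0")
      case True
      have "(1 - \<epsilon>) * real (card (\<F> p)) * b ^ 1 \<le> (b - 1) ^ x p * star p" if p: "p \<in> I" for p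
      proof (rule card_family_le[OF p])
        fix T S assume T: "subspace T" "T \<subseteq> C p" "dim T = t" and S: "subspace S" "T \<subseteq> S" "dim S < t + 1"
        have "T = C p" using T C[OF p] True p by (intro subspace_dim_equal) auto
        moreover have "T = S" using T S by (intro subspace_dim_equal) auto
        ultimately have "almost_covers S p" "dim S = t" using C[OF p] T by auto
        then show "\<exists>j\<in>I - {p}. \<not> almost_covers S j" using none S(1) by blast
      qed (use C[OF p] in auto)
      then show ?thesis using True card_I by (intro exI[of _ "\<lambda>_. 1"]) auto
    next
      case False
      have "I \<noteq> {}" using r card_I by auto
      then have "Max (x ` I) \<in> x ` I" using finite_I by (intro Max_in) auto
      then obtain i1 where i1: "i1 \<in> I" "x i1 = Max (x ` I)" by auto
      then have x_le_i1: "x i \<le> x i1" if "i \<in> I" for i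
        using that finite_I by simp
      have "card (I - {i1}) \<noteq> 0" using r card_I card_Diff_singleton[OF i1(1)] by simp
      then have "I - {i1} \<noteq> {}" by (metis card.empty)
      then obtain i2 where i2: "i2 \<in> I" "i2 \<noteq> i1" by auto
      (* The two special indices exchange their values, so the sum of y is at least that of x. *)
      define y where "y i = (if i = i1 then x i2 else x i1)" for i
      have split: "(\<Sum>i\<in>I. f i) = f i1 + (f i2 + (\<Sum>i\<in>I - {i1} - {i2}. f i))" for f :: "'i \<Rightarrow> nat"
        using sum.remove[OF finite_I i1(1), of f] sum.remove[of "I - {i1}" i2 f] finite_I i2 by simp
      have "(\<Sum>i\<in>I - {i1} - {i2}. x i) \<le> (\<Sum>i\<in>I - {i1} - {i2}. y i)"
        using x_le_i1 by (intro sum_mono) (auto simp: y_def)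
      then have "(\<Sum>i\<in>I. x i) \<le> (\<Sum>i\<in>I. y i)"
        unfolding split using i2 by (simp add: y_def)
      moreover have "r - 1 \<le> (\<Sum>i\<in>I. y i)"
      proof -
        have x1: "1 \<le> x i1" using False x_le_i1 by (metis le_zero_eq less_one not_le)
        have "r - 1 = (\<Sum>i\<in>I - {i1}. 1)" using card_I i1 finite_I by simp
        also have "\<dots> \<le> (\<Sum>i\<in>I - {i1}. y i)" using x1 by (intro sum_mono) (auto simp: y_def)
        also have "\<dots> \<le> (\<Sum>i\<in>I. y i)" using finite_I by (intro sum_mono2) auto
        finally show ?thesis .
      qed
      moreover have "(1 - \<epsilon>) * real (card (\<F> p)) * b ^ y p \<le> (b - 1) ^ x p * star p" if p: "p \<in> I" for p
      proof (rule card_family_le[OF p])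
        fix T S assume S: "subspace S" "dim S < t + y p"
        have "\<exists>j\<in>I - {p}. x j = y p" using i1 i2 by (auto simp: y_def)
        then show "\<exists>j\<in>I - {p}. \<not> almost_covers S j" using x_le S by (metis Diff_iff not_le)
      qed (use C[OF p] in auto)
      ultimately show ?thesis by blast
    qed
    then obtain y where y: "(\<Sum>i\<in>I. x i) \<le> (\<Sum>i\<in>I. y i)" "r - 1 \<le> (\<Sum>i\<in>I. y i)"
      and bound: "\<And>p. p \<in> I \<Longrightarrow> (1 - \<epsilon>) * real (card (\<F> p)) * b ^ y p \<le> (b - 1) ^ x p * star p"
      by blast
    define N where "N = (\<Sum>i\<in>I. y i)"
    define K where "K = (\<Prod>i\<in>I. real (card (\<F> i)))"
    have K: "K > 0" unfolding K_def using card_pos by (rule prod_pos)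
    have "(1 - \<epsilon>) ^ r * K * b ^ N = (\<Prod>i\<in>I. (1 - \<epsilon>) * real (card (\<F> i)) * b ^ y i)"
      by (simp add: prod.distrib card_I K_def N_def power_sum)
    also have "\<dots> \<le> (\<Prod>i\<in>I. (b - 1) ^ x i * star i)"
      using bound \<epsilon>_le b_ge_4 by (intro prod_mono) auto
    also have "\<dots> = (b - 1) ^ (\<Sum>i\<in>I. x i) * (\<Prod>i\<in>I. star i)"
      by (simp add: prod.distrib power_sum)
    also have "\<dots> \<le> (b - 1) ^ N * K"
      using heavy y b_ge_4 unfolding N_def K_def
      by (intro mult_mono power_increasing prod_nonneg) (auto simp: gauss_nonneg[OF Q_ge_2])
    finally have "(1 - \<epsilon>) ^ r * b ^ N \<le> (b - 1) ^ N" using K by simp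
    moreover have "(1 - 1 / b) ^ N = (b - 1) ^ N / b ^ N"
      using b_ge_4 by (simp add: diff_divide_distrib flip: power_divide)
    ultimately have "(1 - \<epsilon>) ^ r \<le> (1 - 1 / b) ^ N"
      using b_ge_4 by (simp add: pos_le_divide_eq)
    also have "\<dots> \<le> (1 - 1 / b) ^ (r - 1)"
      using y(2) b_ge_4 unfolding N_def by (intro power_decreasing) auto
    also have "\<dots> \<le> ((1 - \<epsilon>)\<^sup>2) ^ (r - 1)"
    proof (rule power_mono)
      have "(1 - \<epsilon>)\<^sup>2 \<ge> 1 - 2 * \<epsilon>" by (simp add: power2_eq_square algebra_simps)
      then show "1 - 1 / b \<le> (1 - \<epsilon>)\<^sup>2" using two_\<epsilon>_le by linarith
    qed (use b_ge_4 in simp)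
    also have "\<dots> = (1 - \<epsilon>) ^ (2 * (r - 1))" by (rule power_mult[symmetric])
    (* As r > 2, the exponent 2 * (r - 1) exceeds r. *)
    also have "\<dots> < (1 - \<epsilon>) ^ r" using \<epsilon>_pos \<epsilon>_le r by (intro power_strict_decreasing) auto
    finally show False by simp
  qed
  then show ?thesis using that by blast
qed

end

section \<open>Members that avoid the common subspace\<close>

context cross_families
begin

lemma almost_covers_card_above:
  assumes i: "i \<in> I" and T: "subspace T" "dim T = t" "almost_covers T i"
  shows "(1 - \<epsilon>) * real (card (\<F> i)) \<le> real (card {F \<in> \<F> i. T \<subseteq> F})"
proof -
  have "T \<subseteq> F" if F: "F \<in> \<F> i" "t \<le> dim (F \<inter> T)" for F
  proof -
    have "subspace (F \<inter> T)" using subspace_member[OF i F(1)] T(1) by (rule subspace_inter)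
    then have "F \<inter> T = T" using T F(2) by (intro subspace_dim_equal) auto
    then show ?thesis by blast
  qed
  then have "card {F \<in> \<F> i. t \<le> dim (F \<inter> T)} \<le> card {F \<in> \<F> i. T \<subseteq> F}"
    by (intro card_mono) auto
  then show ?thesis using almost_covers_card[OF T(3)] by linarith
qed

text \<open>
  A single member \<open>F'\<close> that does not contain \<open>T\<close> makes a branching step at \<open>T\<close> possible for
  every other family. One member is too little for \<open>small_intersection\<close>, but now the remaining
  families may be restricted to their members above \<open>T\<close>, which loses little. In a transversal
  with least intersection \<open>M\<close> all members except \<open>F'\<close> contain \<open>T\<close>, so that \<open>T\<close> meets every
  relevant intersection in \<open>T \<inter> F'\<close>, of dimension \<open>z < t\<close>. If \<open>M\<close> were too large, the
  members above \<open>T\<close> would be so few that their product would fall short by a factor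
  \<open>q ^ r\<close>, while only \<open>(1 - \<epsilon>) ^ r\<close> can have been lost.
\<close>

lemma branching_space_of_stray_member:
  assumes T: "subspace T" "dim T = t" "\<And>i. i \<in> I \<Longrightarrow> almost_covers T i"
    and a: "a \<in> I" "F' \<in> \<F> a" "\<not> T \<subseteq> F'" and p: "p \<in> I - {a}"
  obtains M where "subspace M" "dim M + 2 \<le> codim p" "dim (T \<inter> M) < t"
    "\<And>F. F \<in> \<F> p \<Longrightarrow> t \<le> dim (F \<inter> M)"
proof -
  define R where "R = I - {p}"
  define R' where "R' = R - {a}"
  define G where "G i = (if i = a then {F'} else {F \<in> \<F> i. T \<subseteq> F})" for i
  have pI: "p \<in> I" "p \<noteq> a" using p by auto
  have R: "finite R" "a \<in> R" "\<And>i. i \<in> R \<Longrightarrow> i \<in> I" using finite_I a p by (auto simp: R_def)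
  have R': "finite R'" "\<And>i. i \<in> R' \<Longrightarrow> i \<in> I \<and> i \<in> R \<and> i \<noteq> a" using R by (auto simp: R'_def)
  note above = almost_covers_card_above[OF _ T(1,2) T(3)]
  have above_le_star: "(1 - \<epsilon>) * real (card (\<F> i)) \<le> star i" if i: "i \<in> I" for i
    using above[OF i i] card_above_le[OF members[OF i] T(1), of t] T(2) t_le_k[OF i] k_le[OF i] by simp
  have "G i \<noteq> {}" if "i \<in> R" for i
  proof (cases "i = a")
    case False
    have "(1 - \<epsilon>) * real (card (\<F> i)) > 0" using card_pos[OF R(3)[OF that]] \<epsilon>_le by simp
    then have "card {F \<in> \<F> i. T \<subseteq> F} \<noteq> 0" using above[OF R(3) R(3), OF that that] by linarith
    then have "{F \<in> \<F> i. T \<subseteq> F} \<noteq> {}" by (metis card.empty)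
    then show ?thesis using False by (simp add: G_def)
  qed (simp add: G_def)
  then obtain F where F: "\<And>i. i \<in> R \<Longrightarrow> F i \<in> G i"
    and min: "\<And>i X. i \<in> R \<Longrightarrow> X \<in> G i \<Longrightarrow> dim (\<Inter>j\<in>R. F j) \<le> dim (X \<inter> (\<Inter>j\<in>R - {i}. F j))"
    using minimal_transversal[of R G] by blast
  have Fa: "F a = F'" using F[OF R(2)] by (simp add: G_def)
  have FT: "F i \<in> \<F> i" "T \<subseteq> F i" if "i \<in> R" "i \<noteq> a" for i using F[OF that(1)] that(2) by (auto simp: G_def)
  have FF: "F i \<in> \<F> i" if "i \<in> R" for i using FT Fa a(2) that by (cases "i = a") auto
  have sub: "subspace (F i)" if "i \<in> R" for i by (rule subspace_member[OF R(3)[OF that] FF[OF that]])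
  define M where "M = (\<Inter>j\<in>R. F j)"
  define A where "A i = (\<Inter>j\<in>R - {i}. F j)" for i
  define s where "s = dim M"
  define z where "z = dim (T \<inter> F')"
  define e where "e i = dim (A i) - s" for i
  have subM: "subspace M" and subA: "subspace (A i)" for i
    unfolding M_def A_def using sub by (auto intro!: subspace_Int)
  have z: "z < t"
  proof (rule ccontr)
    assume "\<not> z < t"
    then have "T \<inter> F' = T"
      using T sub[OF R(2)] Fa by (intro subspace_dim_equal subspace_inter) (auto simp: z_def)
    then show False using a(3) by blast
  qed
  have TM: "T \<inter> M = T \<inter> F'"
  proof -
    have "M \<subseteq> F'" using R(2) Fa by (auto simp: M_def)
    moreover have "T \<inter> F' \<subseteq> M" using FT Fa unfolding M_def by (metis INT_greatest inf_le1 inf_le2 order_trans)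
    ultimately show ?thesis by blast
  qed
  have "dim M + 2 \<le> codim p"
  proof (rule ccontr)
    assume "\<not> dim M + 2 \<le> codim p"
    then have cs: "c \<le> s + 1" using c_le_codim[OF pI(1)] by (simp add: s_def)
    then have st: "t + 1 \<le> s" using c_ge by simp
    have dimA: "dim (A i) = s + e i" for i
    proof -
      have "M \<subseteq> A i" by (auto simp: M_def A_def)
      then show ?thesis using dim_subset by (simp add: e_def s_def)
    qed
    have cardG: "real (card (G i)) \<le> Q powi (int (s - z + 1) * int (e i) - int (s - z) * int (codim i)) * star i"
      if i: "i \<in> R'" for i
    proof -
      note i' = R'(2)[OF i, THEN conjunct1] R'(2)[OF i, THEN conjunct2, THEN conjunct1]
        R'(2)[OF i, THEN conjunct2, THEN conjunct2]
      have G: "G i = {F \<in> \<F> i. T \<subseteq> F}" using i' by (simp add: G_def)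
      have "A i \<subseteq> F'" using R(2) Fa i' by (auto simp: A_def)
      moreover have "T \<inter> F' \<subseteq> A i" using TM by (auto simp: M_def A_def)
      ultimately have TA: "T \<inter> A i = T \<inter> F'" by blast
      have Gk: "G i \<subseteq> grassmannian (k i)" using members[OF i'(1)] by (auto simp: G)
      have meet: "T \<subseteq> X \<and> s \<le> dim (X \<inter> A i)" if X: "X \<in> G i" for X
        using min[OF i'(2) X] X by (simp add: s_def M_def A_def G)
      have dim_k: "t \<le> k i" "k i \<le> dimension"
        using t_le_k[OF i'(1)] k_le[OF i'(1)] by simp_all
      have "dim (T \<inter> A i) = z" "z \<le> s" "t + z \<le> dim T + s"
        unfolding TA z_def[symmetric] T(2) using z st by simp_all
      from card_meeting_le_powi[OF Gk dim_k meet T(1) subA dimA this] T(2) show ?thesis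
        using z st by simp
    qed
    define E where "E = (\<Sum>i\<in>R'. int (e i))"
    define C where "C = (\<Sum>i\<in>R'. int (codim i))"
    define m where "m = int r - 2"
    have cardR': "card R' = r - 2"
      using card_Diff_singleton[OF R(2)] card_Diff_singleton[OF pI(1)] card_I by (simp add: R'_def R_def)
    have E: "E \<le> int dimension - int c - int s"
    proof -
      have "(\<Sum>j\<in>R'. e j) + s \<le> dim (\<Inter>l\<in>R - R'. F l)"
        using sum_dim_defects_le[of R F R'] sub R(1) by (simp add: e_def A_def s_def M_def R'_def)
      also have "R - R' = {a}" using R(2) by (auto simp: R'_def)
      finally have "(\<Sum>j\<in>R'. e j) + s \<le> k a" using dim_member[OF a(1,2)] Fa by simp
      then have "(\<Sum>j\<in>R'. e j) + s + c \<le> dimension" using k_le[OF a(1)] by simp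
      then have "int (\<Sum>j\<in>R'. e j) + int s + int c \<le> int dimension" by linarith
      then show ?thesis unfolding E_def by simp
    qed
    have mC: "m * int c \<le> C"
    proof -
      have "(\<Sum>i\<in>R'. int c) \<le> C" unfolding C_def using c_le_codim R'(2) by (intro sum_mono) force
      then show ?thesis using cardR' r by (simp add: m_def of_nat_diff)
    qed
    have "int dimension + (m + 2) * int t + m + 1 \<le> (m + 2) * int c"
    proof -
      have "int (dimension + r * t + (r - 1)) \<le> int (r * c)" using threshold by (simp only: of_nat_le_iff)
      then show ?thesis using r by (simp add: m_def of_nat_diff)
    qed
    then have X: "(int s - int z + 1) * E - (int s - int z) * C \<le> - (m + 2)"
      using r t st cs z E mC by (intro exponent_bound_fixed[where n = "int dimension" and t = "int t" and c = "int c"]) (auto simp: m_def)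
    have prod_split: "(\<Prod>i\<in>I. f i) = f p * (f a * (\<Prod>i\<in>R'. f i))" for f :: "'i \<Rightarrow> real"
      unfolding R'_def R_def
      using prod.remove[OF finite_I pI(1), of f] prod.remove[OF R(1,2), of f] by (simp add: R_def)
    define K where "K = (\<Prod>i\<in>I. star i)"
    have K: "K > 0" unfolding K_def using star_pos by (rule prod_pos)
    have "(1 - \<epsilon>) ^ r * K \<le> (1 - \<epsilon>) ^ r * (\<Prod>i\<in>I. real (card (\<F> i)))"
      unfolding K_def using heavy \<epsilon>_le by (intro mult_left_mono) auto
    also have "\<dots> = (\<Prod>i\<in>I. (1 - \<epsilon>) * real (card (\<F> i)))"
      by (simp add: prod.distrib card_I)
    also have "\<dots> = ((1 - \<epsilon>) * real (card (\<F> p))) * (((1 - \<epsilon>) * real (card (\<F> a)))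
        * (\<Prod>i\<in>R'. (1 - \<epsilon>) * real (card (\<F> i))))" by (rule prod_split)
    also have "\<dots> \<le> star p * (star a *
        (\<Prod>i\<in>R'. Q powi (int (s - z + 1) * int (e i) - int (s - z) * int (codim i)) * star i))"
    proof -
      have "(\<Prod>i\<in>R'. (1 - \<epsilon>) * real (card (\<F> i)))
          \<le> (\<Prod>i\<in>R'. Q powi (int (s - z + 1) * int (e i) - int (s - z) * int (codim i)) * star i)"
      proof (rule prod_mono)
        fix i assume i: "i \<in> R'"
        then have i': "i \<in> I" using R'(2) by blast
        have "G i = {F \<in> \<F> i. T \<subseteq> F}" using R'(2)[OF i] by (simp add: G_def)
        then show "0 \<le> (1 - \<epsilon>) * real (card (\<F> i)) \<and> (1 - \<epsilon>) * real (card (\<F> i))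
            \<le> Q powi (int (s - z + 1) * int (e i) - int (s - z) * int (codim i)) * star i"
          using above[of i, OF i' i'] cardG[OF i] \<epsilon>_le by simp
      qed
      moreover have "0 \<le> (\<Prod>i\<in>R'. (1 - \<epsilon>) * real (card (\<F> i)))"
        using \<epsilon>_le by (intro prod_nonneg) simp
      ultimately show ?thesis
        using above_le_star[OF pI(1)] above_le_star[OF a(1)] \<epsilon>_le gauss_nonneg[OF Q_ge_2]
        by (intro mult_mono) simp_all
    qed
    also have "\<dots> = Q powi (\<Sum>i\<in>R'. int (s - z + 1) * int (e i) - int (s - z) * int (codim i)) * K"
      using Q_ge_2 by (simp add: K_def prod_split prod.distrib prod_powi mult_ac)
    also have "(\<Sum>i\<in>R'. int (s - z + 1) * int (e i) - int (s - z) * int (codim i))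
        = (int s - int z + 1) * E - (int s - int z) * C"
      using st z by (simp add: sum_subtractf E_def C_def of_nat_diff flip: sum_distrib_left)
    also have "Q powi ((int s - int z + 1) * E - (int s - int z) * C) * K \<le> Q powi (- (m + 2)) * K"
      using X Q_ge_2 K by (intro mult_right_mono power_int_increasing) auto
    also have "Q powi (- (m + 2)) = (1 / Q) ^ r"
      by (simp add: m_def power_int_minus power_one_over inverse_eq_divide)
    finally have "(1 - \<epsilon>) ^ r \<le> (1 / Q) ^ r" using K by simp
    then have "1 - \<epsilon> \<le> 1 / Q"
      using r Q_ge_2 \<epsilon>_le by (subst (asm) power_mono_iff) auto
    moreover have "1 / Q \<le> 1 / 2" using Q_ge_2 by (intro divide_left_mono) auto
    ultimately show False using \<epsilon>_le by simp
  qed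
  moreover have "t \<le> dim (X \<inter> M)" if "X \<in> \<F> p" for X
    unfolding M_def R_def by (rule cross_Int[OF pI(1) _ that]) (use FF in \<open>simp add: R_def\<close>)
  moreover have "dim (T \<inter> M) < t" using z unfolding TM z_def .
  ultimately show ?thesis using that subM by blast
qed

text \<open>
  If some member of \<open>\<F> a\<close> did not contain the common space \<open>T\<close>, all the other families would lose
  a factor \<open>b\<close>, which is more than the \<open>r\<close> factors \<open>1 - \<epsilon>\<close> can make up for.
\<close>

lemma common_subspace:
  obtains T where "subspace T" "dim T = t" "\<And>i F. i \<in> I \<Longrightarrow> F \<in> \<F> i \<Longrightarrow> T \<subseteq> F"
proof -
  obtain T where T: "subspace T" "dim T = t" "\<And>i. i \<in> I \<Longrightarrow> almost_covers T i"
    by (rule common_cover) blast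
  have "T \<subseteq> F'" if a: "a \<in> I" "F' \<in> \<F> a" for a F'
  proof (rule ccontr)
    assume stray: "\<not> T \<subseteq> F'"
    have b: "b > 0" using b_ge_4 by simp
    note above = almost_covers_card_above[OF _ T(1,2) T(3)]
    have bound: "(1 - \<epsilon>) * real (card (\<F> i)) \<le> star i * (if i = a then 1 else 1 / b)" if i: "i \<in> I" for i
    proof (cases "i = a")
      case True
      then show ?thesis
        using above[OF i i] card_above_le[OF members[OF i] T(1), of t] T(2) t_le_k[OF i] k_le[OF i] by simp
    next
      case False
      then obtain M where M: "subspace M" "dim M + 2 \<le> codim i" "dim (T \<inter> M) < t"
        and meet: "\<And>F. F \<in> \<F> i \<Longrightarrow> t \<le> dim (F \<inter> M)"
        using branching_space_of_stray_member[OF T a stray, of i] i by blast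
      have "real (card {F \<in> \<F> i. T \<subseteq> F}) * b ^ (t + 1 - dim T)
          \<le> Q powi (- (int (codim i) * int (dim T - t))) * star i"
      proof (rule card_branch[OF i T(1) _ M meet])
        fix W assume "subspace W" "T \<subseteq> W" "dim W = dim T + (t - dim (T \<inter> M))"
        then show "real (card {F \<in> \<F> i. W \<subseteq> F}) * b ^ (t + 1 - dim W)
            \<le> Q powi (- (int (codim i) * int (dim W - t))) * star i"
          using T(2) M(3) by (intro card_above_weighted[OF i]) simp_all
      qed (use T(2) in simp_all)
      then have "real (card {F \<in> \<F> i. T \<subseteq> F}) * b \<le> star i" using T(2) by simp
      then have "real (card {F \<in> \<F> i. T \<subseteq> F}) \<le> star i / b" using b by (simp add: le_divide_eq)
      then show ?thesis using above[OF i i] False by simp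
    qed
    define K where "K = (\<Prod>i\<in>I. star i)"
    have K: "K > 0" unfolding K_def using star_pos by (rule prod_pos)
    have "(1 - \<epsilon>) ^ r * K \<le> (1 - \<epsilon>) ^ r * (\<Prod>i\<in>I. real (card (\<F> i)))"
      unfolding K_def using heavy \<epsilon>_le by (intro mult_left_mono) auto
    also have "\<dots> = (\<Prod>i\<in>I. (1 - \<epsilon>) * real (card (\<F> i)))"
      by (simp add: prod.distrib card_I)
    also have "\<dots> \<le> (\<Prod>i\<in>I. star i * (if i = a then 1 else 1 / b))"
      using bound \<epsilon>_le by (intro prod_mono) auto
    also have "\<dots> = K * (\<Prod>i\<in>I. if i = a then 1 else 1 / b)" by (simp add: prod.distrib K_def)
    also have "(\<Prod>i\<in>I. if i = a then 1 else 1 / b) = (1 / b) ^ (r - 1)"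
      using prod.remove[OF finite_I a(1), of "\<lambda>i. if i = a then 1 else 1 / b"] a(1) card_I
      by (simp add: card_Diff_singleton)
    finally have 1: "(1 - \<epsilon>) ^ r \<le> (1 / b) ^ (r - 1)" using K by (simp add: mult.commute)
    have "(7 / 8 :: real) ^ r \<le> (1 - \<epsilon>) ^ r" using \<epsilon>_le by (intro power_mono) auto
    moreover have "(1 / b) ^ (r - 1) \<le> (1 / 4) ^ (r - 1)"
      using b_ge_4 by (intro power_mono divide_left_mono) auto
    moreover obtain u where "r = Suc u" "u \<ge> 2" using r by (cases r) auto
    moreover have "(7 / 8 :: real) * (7 / 8) ^ u > (1 / 4) ^ u" if "u \<ge> 2" for u :: nat
      using that
    proof (induction u rule: dec_induct)
      case (step u)
      have "(1 / 4 :: real) ^ u > 0" by simp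
      then show ?case unfolding power_Suc using step.IH by linarith
    qed (simp add: power2_eq_square)
    ultimately show False using 1 by fastforce
  qed
  then show ?thesis using that T by blast
qed

text \<open>
  Families of spaces above \<open>T\<close> can attain the product only if each of them is complete.
\<close>

lemma families_complete:
  obtains T where "T \<in> grassmannian t"
    "\<And>i. i \<in> I \<Longrightarrow> \<F> i = {F \<in> grassmannian (k i). T \<subseteq> F}"
proof -
  obtain T where T: "subspace T" "dim T = t" "\<And>i F. i \<in> I \<Longrightarrow> F \<in> \<F> i \<Longrightarrow> T \<subseteq> F"
    by (rule common_subspace) blast
  define S where "S i = {F \<in> grassmannian (k i). T \<subseteq> F}" for i
  have sub: "\<F> i \<subseteq> S i" if "i \<in> I" for i using T(3)[OF that] members[OF that] unfolding S_def by blast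
  have card_S: "real (card (S i)) = star i" if "i \<in> I" for i
    using card_grassmannian_above[OF T(1), of "k i"] T(2) t_le_k[OF that] by (simp add: S_def)
  have "\<F> a = S a" if a: "a \<in> I" for a
  proof (rule card_subset_eq[OF _ sub[OF a]], simp, rule ccontr)
    assume "card (\<F> a) \<noteq> card (S a)"
    then have less: "real (card (\<F> a)) < star a"
      using card_mono[OF _ sub[OF a]] card_S[OF a] by simp
    have le: "real (card (\<F> i)) \<le> star i" if "i \<in> I" for i
      using card_mono[OF _ sub[OF that]] card_S[OF that] by simp
    have "(\<Prod>i\<in>I. real (card (\<F> i))) < (\<Prod>i\<in>I. star i)"
      unfolding prod.remove[OF finite_I a, of star] prod.remove[OF finite_I a, of "\<lambda>i. real (card (\<F> i))"]
    proof (rule mult_less_le_imp_less[OF less])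
      show "(\<Prod>i\<in>I - {a}. real (card (\<F> i))) \<le> (\<Prod>i\<in>I - {a}. star i)"
        using le by (intro prod_mono) auto
      show "0 < (\<Prod>i\<in>I - {a}. real (card (\<F> i)))"
        using card_pos by (intro prod_pos) auto
    qed simp
    then show False using heavy by simp
  qed
  moreover have "T \<in> grassmannian t" using T(1,2) by (simp add: grassmannian_def)
  ultimately show ?thesis by (intro that[of T]) (simp_all add: S_def)
qed

end

section \<open>The maximal product\<close>

theorem theorem1p1:
  fixes scale :: "'a::{field,finite} \<Rightarrow> 'b::ab_group_add \<Rightarrow> 'b"
    and q r t n :: nat
    and k :: "nat \<Rightarrow> nat"
    and \<F> :: "nat \<Rightarrow> 'b set set"
  assumes "vector_space scale"
    and "card (UNIV :: 'a set) = q"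
    and "vector_space.dim scale (UNIV :: 'b set) = n"
    and "r \<ge> 3"
    and "antimono_on {1..r} k"
    and "k r \<ge> t"
    and "t \<ge> 1"
    and "real n \<ge> real r / (real r - 1) * (real (k 1) + real t) + 1"
    and "\<forall>i\<in>{1..r}. \<F> i \<subseteq> vector_space.grassmannian scale (k i)"
    and "vector_space.cross_intersecting scale r t \<F>"
  shows "real (\<Prod>i=1..r. card (\<F> i))
           \<le> (\<Prod>i=1..r. gauss_binomial q (int n - int t) (int (k i) - int t))
       \<and> (real (\<Prod>i=1..r. card (\<F> i))
             = (\<Prod>i=1..r. gauss_binomial q (int n - int t) (int (k i) - int t))
           \<longleftrightarrow> (\<exists>T\<in>vector_space.grassmannian scale t. \<forall>i\<in>{1..r}.
                  \<F> i = {F \<in> vector_space.grassmannian scale (k i). T \<subseteq> F}))"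
proof -
  interpret V: vector_space scale by fact
  have r1: "real r > 1" using assms(4) by simp
  have bound: "real r * (real (k 1) + real t) + (real r - 1) \<le> (real r - 1) * real n"
  proof -
    have "(real r - 1) * (real r / (real r - 1) * (real (k 1) + real t) + 1) \<le> (real r - 1) * real n"
      using assms(8) r1 by (intro mult_left_mono) auto
    moreover have "(real r - 1) * (real r / (real r - 1) * (real (k 1) + real t) + 1)
        = real r * (real (k 1) + real t) + (real r - 1)"
      using r1 by (simp add: field_simps)
    ultimately show ?thesis by simp
  qed
  have "real (r * (k 1 + t) + (r - 1)) \<le> real ((r - 1) * n)"
    using bound assms(4) by (simp add: of_nat_diff)
  then have bound_nat: "r * (k 1 + t) + (r - 1) \<le> (r - 1) * n" by (simp only: of_nat_le_iff)
  have k1n: "k 1 \<le> n"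
  proof (rule ccontr)
    assume "\<not> k 1 \<le> n"
    then have "(r - 1) * n \<le> r * k 1" by (intro mult_le_mono) auto
    then show False using bound_nat assms(4,7) by (simp add: add_mult_distrib2)
  qed
  have n0: "n > 0"
  proof (rule ccontr)
    assume "\<not> n > 0"
    then show False using bound_nat assms(4) by simp
  qed
  have kr: "t \<le> k i" "k i \<le> k 1" if "i \<in> {1..r}" for i
    using assms(5,6) that monotone_onD[OF assms(5), of i r] monotone_onD[OF assms(5), of 1 i] by auto
  obtain B where B: "V.independent B" "V.span B = UNIV" "card B = n"
    using V.basis_exists[of UNIV] assms(3) by (metis subset_UNIV top.extremum_uniqueI)
  (* For an infinite-dimensional space dim is 0 by default; n > 0 excludes that. *)
  have "finite B" using B(3) n0 by (metis card.infinite less_irrefl)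
  then interpret V: finite_field_space scale B q
    by unfold_locales (use B assms(2) in auto)
  have dim: "V.dimension = n" using B(3) by (simp add: V.dimension_def)
  define star where "star i = gauss (real q) (n - t) (k i - t)" for i
  have gb: "gauss_binomial q (int n - int t) (int (k i) - int t) = star i" if "i \<in> {1..r}" for i
    unfolding star_def using kr[OF that] k1n V.Q_ge_2 by (intro gauss_binomial_eq_gauss) auto
  have prod_gb: "(\<Prod>i=1..r. gauss_binomial q (int n - int t) (int (k i) - int t)) = (\<Prod>i=1..r. star i)"
    using gb by (intro prod.cong) auto
  have card_star: "real (card {F \<in> V.grassmannian (k i). T \<subseteq> F}) = star i"
    if "i \<in> {1..r}" "T \<in> V.grassmannian t" for i T
    using V.card_grassmannian_above[of T "k i"] that kr[OF that(1)]
    by (simp add: V.grassmannian_def star_def dim)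
  have threshold: "n + r * t + (r - 1) \<le> r * (n - k 1)"
  proof -
    obtain d where d: "n = k 1 + d" using k1n le_Suc_ex by blast
    obtain u where u: "r = Suc u" using assms(4) by (cases r) auto
    show ?thesis using bound_nat by (simp add: d u algebra_simps)
  qed
  have extremal: "\<exists>T\<in>V.grassmannian t. \<forall>i\<in>{1..r}. \<F> i = {F \<in> V.grassmannian (k i). T \<subseteq> F}"
    if heavy: "(\<Prod>i=1..r. star i) \<le> real (\<Prod>i=1..r. card (\<F> i))"
  proof -
    interpret C: cross_families scale B q "{1..r}" r t "n - k 1" k \<F>
    proof unfold_locales
      show "V.dimension + r * t + (r - 1) \<le> r * (n - k 1)" using threshold dim by simp
      show "t \<le> V.dim (\<Inter>i\<in>{1..r}. F i)" if "\<And>i. i \<in> {1..r} \<Longrightarrow> F i \<in> \<F> i" for F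
        using assms(10) that unfolding V.cross_intersecting_def by blast
      show "(\<Prod>i\<in>{1..r}. gauss (real q) (V.dimension - t) (k i - t)) \<le> (\<Prod>i\<in>{1..r}. real (card (\<F> i)))"
        using heavy by (simp add: star_def dim)
      show "k i + (n - k 1) \<le> V.dimension" if "i \<in> {1..r}" for i
        using kr[OF that] k1n dim by simp
    qed (use assms kr in auto)
    show ?thesis by (rule C.families_complete) blast
  qed
  have eq: "real (\<Prod>i=1..r. card (\<F> i)) = (\<Prod>i=1..r. star i)"
    if "\<exists>T\<in>V.grassmannian t. \<forall>i\<in>{1..r}. \<F> i = {F \<in> V.grassmannian (k i). T \<subseteq> F}"
    using that card_star by (auto intro!: prod.cong)
  show ?thesis
  proof (cases "(\<Prod>i=1..r. star i) \<le> real (\<Prod>i=1..r. card (\<F> i))")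
    case True
    show ?thesis unfolding prod_gb using extremal[OF True] eq[OF extremal[OF True]] by simp
  next
    case False
    then show ?thesis unfolding prod_gb using eq by linarith
  qed
qed

end
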